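(* For every integer $k>0$, the class $\mathcal{KP}(k)$ of all finite ordered $k$-polyhedra has the Ramsey property: for every integer $r>1$ and all $\mathbb A,\mathbb B\in\mathcal{KP}(k)$ with $\mathbb A\leq\mathbb B$, there is $\mathbb C\in\mathcal{KP}(k)$ such that for every $r$-coloring $c:\binom{\mathbb C}{\mathbb A}\to r$ there exists $\mathbb B'\in\binom{\mathbb C}{\mathbb B}$ for which $\binom{\mathbb B'}{\mathbb A}$ is monochromatic. Furthermore, $\mathcal{KP}(k)$ is the age of some Fraïssé structure.
   Context: A polyhedron is a pair $(A,S_A)$ with $A$ a countable set and $S_A$ a hereditary family of finite subsets of $A$ ($u\subseteq v\in S_A$ implies $u\in S_A$) with $\bigcup S_A=A$. It is viewed as a structure in the signature with one $i$-ary relation symbol $R_i$ for each $i\geq1$, where $(a_1,\dots,a_i)\in R_i$ iff the $a_j$ are distinct and $\{a_1,\dots,a_i\}\in S_A$. An ordered polyhedron is a polyhedron with a total order $<$ on $A$, as a structure in the expanded signature. $\mathcal{KP}(k)$ is the class of finite ordered polyhedra $(A,S_A)$ all of whose faces $u\in S_A$ satisfy $|u|\leq k$; equivalently, the closure under isomorphism of the set $\mathcal{AP}(k)$ of such pairs with $A\subseteq\mathbb N$ finite carrying the natural order. $\mathbb A\leq\mathbb B$ means $\mathbb A$ is a substructure of $\mathbb B$ (induced relations and order), and $\binom{\mathbb B}{\mathbb A}$ is the set of substructures of $\mathbb B$ isomorphic to $\mathbb A$. The age of a structure is the class of all finite structures isomorphic to some substructure of it. A Fraïssé structure is a countable, locally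 finite structure that is ultrahomogeneous (each isomorphism between finite substructures extends to an automorphism). *)

theory Defs
  imports Main "HOL-Library.Countable_Set"
begin

text \<open>
  The signature has an \<open>i\<close>-ary relation symbol for each \<open>i \<ge> 1\<close> and the binary symbol \<open><\<close>.
  Tuples are lists. Empty structures are admitted. Index \<open>0\<close> is not a symbol, so its value
  is fixed to be empty in order that equality of records is equality of structures.
\<close>

record 'a struct =
  univ :: "'a set"
  Rel :: "nat \<Rightarrow> 'a list set"
  Less :: "('a \<times> 'a) set"

definition is_struct :: "'a struct \<Rightarrow> bool" where
  "is_struct M \<longleftrightarrow>
     Rel M 0 = {} \<and>
     (\<forall>i\<ge>1. Rel M i \<subseteq> {xs. length xs = i \<and> set xs \<subseteq> univ M}) \<and>
     Less M \<subseteq> univ M \<times> univ M"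

definition substruct :: "'a struct \<Rightarrow> 'a struct \<Rightarrow> bool"  (infix "\<unlhd>" 50) where
  "M \<unlhd> N \<longleftrightarrow>
     is_struct M \<and> is_struct N \<and> univ M \<subseteq> univ N \<and>
     (\<forall>i\<ge>1. Rel M i = {xs \<in> Rel N i. set xs \<subseteq> univ M}) \<and>
     Less M = Less N \<inter> (univ M \<times> univ M)"

definition struct_iso :: "('a \<Rightarrow> 'b) \<Rightarrow> 'a struct \<Rightarrow> 'b struct \<Rightarrow> bool" where
  "struct_iso f M N \<longleftrightarrow>
     is_struct M \<and> is_struct N \<and> bij_betw f (univ M) (univ N) \<and>
     (\<forall>i\<ge>1. \<forall>xs. length xs = i \<longrightarrow> set xs \<subseteq> univ M \<longrightarrow>
        (xs \<in> Rel M i \<longleftrightarrow> map f xs \<in> Rel N i)) \<and>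
     (\<forall>x\<in>univ M. \<forall>y\<in>univ M. (x, y) \<in> Less M \<longleftrightarrow> (f x, f y) \<in> Less N)"

definition isomorphic :: "'a struct \<Rightarrow> 'b struct \<Rightarrow> bool"  (infix "\<simeq>" 50) where
  "M \<simeq> N \<longleftrightarrow> (\<exists>f. struct_iso f M N)"

definition copies :: "'b struct \<Rightarrow> 'a struct \<Rightarrow> 'b struct set" where
  "copies B A = {A'. A' \<unlhd> B \<and> A' \<simeq> A}"

text \<open>
  The age is a class of structures over all types; \<open>age F\<close> is its part over the type \<open>'b\<close>,
  which need not be the type underlying \<open>F\<close>.
\<close>

definition age :: "'a struct \<Rightarrow> 'b struct set" where
  "age F = {X. is_struct X \<and> finite (univ X) \<and> (\<exists>M. M \<unlhd> F \<and> X \<simeq> M)}"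

text \<open>
  Local finiteness: the substructure generated by a finite set is finite. The signature being
  relational, this always holds here.
\<close>

definition locally_finite :: "'a struct \<Rightarrow> bool" where
  "locally_finite F \<longleftrightarrow>
     (\<forall>X. finite X \<and> X \<subseteq> univ F \<longrightarrow> finite (\<Inter>{univ M |M. M \<unlhd> F \<and> X \<subseteq> univ M}))"

definition ultrahomogeneous :: "'a struct \<Rightarrow> bool" where
  "ultrahomogeneous F \<longleftrightarrow>
     (\<forall>M N f. M \<unlhd> F \<and> N \<unlhd> F \<and> finite (univ M) \<and> finite (univ N) \<and> struct_iso f M N \<longrightarrow>
        (\<exists>g. struct_iso g F F \<and> (\<forall>x\<in>univ M. g x = f x)))"

definition fraisse_struct :: "'a struct \<Rightarrow> bool" where
  "fraisse_struct F \<longleftrightarrow>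
     is_struct F \<and> countable (univ F) \<and> locally_finite F \<and> ultrahomogeneous F"

definition polyhedron :: "'a set \<Rightarrow> 'a set set \<Rightarrow> bool" where
  "polyhedron A S \<longleftrightarrow>
     countable A \<and> (\<forall>u\<in>S. finite u) \<and> (\<forall>u v. u \<subseteq> v \<and> v \<in> S \<longrightarrow> u \<in> S) \<and> \<Union>S = A"

definition ordered_polyhedron :: "'a set \<Rightarrow> 'a set set \<Rightarrow> ('a \<times> 'a) set \<Rightarrow> bool" where
  "ordered_polyhedron A S L \<longleftrightarrow>
     polyhedron A S \<and> L \<subseteq> A \<times> A \<and> strict_linear_order_on A L"

definition poly_struct :: "'a set \<Rightarrow> 'a set set \<Rightarrow> ('a \<times> 'a) set \<Rightarrow> 'a struct" where
  "poly_struct A S L =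
     \<lparr>univ = A,
      Rel = (\<lambda>i. {xs. i \<ge> 1 \<and> length xs = i \<and> distinct xs \<and> set xs \<in> S}),
      Less = L\<rparr>"

definition KP :: "nat \<Rightarrow> 'a struct set" where
  "KP k = {poly_struct A S L |A S L.
             ordered_polyhedron A S L \<and> finite A \<and> (\<forall>u\<in>S. card u \<le> k)}"

end

(*
  Ramsey property. Subsets of {..<N} form an ordered polyhedron: at most k subsets span a face iff
  they have a common element, and the order is lexicographic. Listing the faces of a finite ordered
  polyhedron B, the empty one included, as f_0, f_1, ... in the order of binary codes, a rigid
  surjection h from {..<N} onto the indices embeds B by sending a vertex v to {n. v \<in> f_(h n)}.
  Tracing the faces of B on a copy of A is again a rigid surjection because the faces are closed
  under subsets, so the copies of A inside such a copy of B are coded by compositions of rigid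
  surjections, and the dual Ramsey theorem of Graham and Rothschild applies.

  Fraisse structure. The vertices are the natural numbers; each one encodes a position in a dense
  order and the link that it prescribes among the smaller vertices. All prescriptions occur
  arbitrarily late, which yields one-point extensions, and back-and-forth does the rest.
*)
theory Submission
  imports Defs "HOL-Library.Nat_Bijection"
begin

text \<open>The Graham-Rothschild theorem is itself proved here. Reading the first parameter trades
  it for a constant, so the theorem for \<open>Suc t\<close> parameters over \<open>a\<close>
  constants comes from the one for \<open>t\<close> parameters over \<open>Suc a\<close> constants;
  without parameters it is the Hales-Jewett theorem. The obstacle in the step is the block of
  constants in front of the first parameter: the colour is reduced to depend on this block alone,
  next on its length alone, and a pigeonhole choice of positions disposes of the length. Binary
  codes are the right order of the faces because they compare two sets by the largest element in
  which they differ: this order extends inclusion, and increasing maps preserve it. Both facts are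
  needed for traces to occur in order. The bound \<open>k\<close> on the faces costs nothing: a set
  of more than \<open>k\<close> vertices is no face of B, so the sets coding these vertices have no
  common element anyway.\<close>

section \<open>Parameter words\<close>

text \<open>\<open>pw a b w\<close>: the word \<open>w\<close> uses the constants \<open>0, ..., a - 1\<close> and the parameters
  \<open>a, ..., b - 1\<close>, each of which occurs, in this order of first occurrences. Reading the first
  occurrence of a parameter turns it into a constant of the rest of the word. For \<open>a = 0\<close> these
  are the rigid surjections onto \<open>{..<b}\<close>.\<close>

fun pw :: "nat \<Rightarrow> nat \<Rightarrow> nat list \<Rightarrow> bool" where
  "pw a b [] \<longleftrightarrow> a = b"
| "pw a b (y # w) \<longleftrightarrow> y < a \<and> pw a b w \<or> y = a \<and> pw (Suc a) b w"

definition PW :: "nat \<Rightarrow> nat \<Rightarrow> nat \<Rightarrow> nat list set" where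
  "PW a b n = {w. pw a b w \<and> length w = n}"

text \<open>A word maps positions to letters, and \<open>sub\<close> composes such maps: the
  parameter \<open>a + i\<close> of \<open>f\<close> becomes the letter \<open>g ! i\<close>. For
  \<open>a = 0\<close> this is the composition of rigid surjections.\<close>

definition sub :: "nat \<Rightarrow> nat list \<Rightarrow> nat list \<Rightarrow> nat list" where
  "sub a f g = map ((!) ([0..<a] @ g)) f"

lemma pw_le: "pw a b w \<Longrightarrow> a \<le> b"
  by (induction a b w rule: pw.induct) auto

lemma pw_less: "pw a b w \<Longrightarrow> y \<in> set w \<Longrightarrow> y < b"
proof (induction a b w rule: pw.induct)
  case (2 a b z w)
  then show ?case using pw_le[of "Suc a" b w] pw_le[of a b w] by auto
qed simp

lemma pw_same: "pw a a w \<longleftrightarrow> set w \<subseteq> {..<a}"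
proof (induction w)
  case (Cons y w)
  then show ?case using pw_le[of "Suc a" a w] by auto
qed simp

lemma pw_append: "pw a b u \<Longrightarrow> pw b c v \<Longrightarrow> pw a c (u @ v)"
  by (induction a b u rule: pw.induct) auto

text \<open>The table is split into \<open>s\<close> and \<open>g\<close> for the sake of the
  induction: when \<open>f\<close> shows a parameter for the first time, this parameter becomes a
  constant and the head of \<open>g\<close> moves to \<open>s\<close>.\<close>

lemma pw_map:
  assumes "pw b c f" "length s = b" "set s \<subseteq> {..<a}" "pw a d g" "b + length g = c"
  shows "pw a d (map ((!) (s @ g)) f)"
  using assms
proof (induction f arbitrary: a b s g)
  case (Cons y f)
  show ?case
  proof (cases "y < b")
    case True
    then have "pw b c f" "(s @ g) ! y < a"
      using Cons.prems pw_le[of "Suc b" c f] by (auto simp: nth_append subset_iff)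
    then show ?thesis using Cons.IH[of b s a g] Cons.prems by simp
  next
    case False
    then have y: "y = b" and f: "pw (Suc b) c f" using Cons.prems(1) by auto
    from pw_le[OF f] Cons.prems(5) obtain z g' where g: "g = z # g'" by (cases g) auto
    have sg: "s @ g = (s @ [z]) @ g'" "(s @ g) ! y = z"
      using g y Cons.prems(2) by (auto simp: nth_append)
    show ?thesis
    proof (cases "z < a")
      case True
      then have "pw a d g'" using Cons.prems(4) g by auto
      then have "pw a d (map ((!) ((s @ [z]) @ g')) f)"
        using True Cons.prems g by (intro Cons.IH[OF f]) auto
      then show ?thesis using True sg by simp
    next
      case False
      then have z: "z = a" and g': "pw (Suc a) d g'" using Cons.prems(4) g by auto
      have "pw (Suc a) d (map ((!) ((s @ [z]) @ g')) f)"
        using z g' Cons.prems g by (intro Cons.IH[OF f]) auto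
      then show ?thesis using z sg by simp
    qed
  qed
qed auto

section \<open>Substitution as composition of words\<close>

lemma length_sub [simp]: "length (sub a f g) = length f"
  by (simp add: sub_def)

lemma sub_append: "sub a (f @ f') g = sub a f g @ sub a f' g"
  by (simp add: sub_def)

lemma sub_PW:
  assumes "f \<in> PW a c n" "g \<in> PW a d (c - a)"
  shows "sub a f g \<in> PW a d n"
proof -
  have "a \<le> c" using assms pw_le by (auto simp: PW_def)
  then show ?thesis
    using assms pw_map[of a c f "[0..<a]" a d g] by (auto simp: PW_def sub_def atLeast0LessThan)
qed

text \<open>Stated for an arbitrary table \<open>s\<close>, because later proofs also evaluate
  composed words by tables with a different number of constants or with a constant replaced by
  another.\<close>

lemma map_nth_sub:
  assumes "f \<in> PW a c n" "length g = c - a"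
  shows "map ((!) s) (sub a f g) = map ((!) (map ((!) s) ([0..<a] @ g))) f"
proof -
  have "a \<le> c" using assms pw_le by (auto simp: PW_def)
  then have "y < length ([0..<a] @ g)" if "y \<in> set f" for y
    using pw_less[OF _ that, of a c] assms by (auto simp: PW_def)
  then show ?thesis by (auto simp: sub_def simp del: map_append)
qed

lemma sub_assoc:
  assumes "f \<in> PW a c n" "length g = c - a"
  shows "sub a (sub a f g) h = sub a f (sub a g h)"
proof -
  have "map ((!) ([0..<a] @ h)) ([0..<a] @ g) = [0..<a] @ sub a g h"
    by (auto simp: sub_def nth_append intro!: nth_equalityI)
  then show ?thesis unfolding sub_def[of a "sub a f g"] map_nth_sub[OF assms]
    by (simp add: sub_def)
qed

lemma finite_PW [simp]: "finite (PW a b n)"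
proof (rule finite_subset)
  show "PW a b n \<subseteq> {w. set w \<subseteq> {..<b} \<and> length w = n}"
    using pw_less by (auto simp: PW_def)
qed (simp add: finite_lists_length_eq)

text \<open>Product colourings: a word records the colours of all \<open>F z w\<close> at once, so
  that one application of a Ramsey statement serves every \<open>z\<close>. Colours are counted by
  the size of the image, since the codes of colour vectors are not small numbers.\<close>

lemma card_image_vec:
  assumes "finite W" "card (c ` W) \<le> r" "\<And>w z. w \<in> V \<Longrightarrow> z \<in> set zs \<Longrightarrow> F z w \<in> W"
  shows "card ((\<lambda>w. to_nat (map (\<lambda>z. c (F z w) :: nat) zs)) ` V) \<le> r ^ length zs"
proof -
  let ?X = "{xs. set xs \<subseteq> c ` W \<and> length xs = length zs}"
  have fin: "finite ?X" using assms(1) by (simp add: finite_lists_length_eq)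
  have "(\<lambda>w. to_nat (map (\<lambda>z. c (F z w)) zs)) ` V \<subseteq> to_nat ` ?X"
    using assms(3) by (auto intro!: imageI)
  then have "card ((\<lambda>w. to_nat (map (\<lambda>z. c (F z w)) zs)) ` V) \<le> card (to_nat ` ?X)"
    using fin by (intro card_mono) auto
  also have "\<dots> \<le> card ?X" using fin by (rule card_image_le)
  also have "\<dots> = card (c ` W) ^ length zs" using assms(1) by (simp add: card_lists_length_eq)
  also have "\<dots> \<le> r ^ length zs" using assms(2) by (rule power_mono) simp
  finally show ?thesis .
qed

lemma vec_eqD:
  assumes "to_nat (map (\<lambda>z. c (F z w) :: nat) zs) = to_nat (map (\<lambda>z. c (F z w')) zs)" "z \<in> set zs"
  shows "c (F z w) = c (F z w')"
  using assms by auto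

lemma pw_replicate_const: "x < a \<Longrightarrow> pw a a (replicate n x)"
  by (auto simp: pw_same)

section \<open>The Hales-Jewett theorem\<close>

text \<open>Shelah's lemma: the colour does not notice exchanging the last two letters \<open>e\<close> and \<open>Suc e\<close>.
  Each new line is found by the pigeonhole principle among the words \<open>e\<close>, ..., \<open>e\<close>,
  \<open>Suc e\<close>, ..., \<open>Suc e\<close>.\<close>

lemma shelah:
  fixes e n :: nat
  defines "b \<equiv> Suc (Suc e)"
  shows "\<exists>N. \<forall>c :: nat list \<Rightarrow> nat. card (c ` PW b b N) \<le> r \<longrightarrow>
    (\<exists>f\<in>PW b (b + n) N. \<forall>g\<in>PW b b n. \<forall>g'\<in>PW b b n.
       map (min e) g = map (min e) g' \<longrightarrow> c (sub b f g) = c (sub b f g'))"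
proof (induction n arbitrary: r)
  case 0
  show ?case by (rule exI[of _ 0]) (auto simp: PW_def)
next
  case (Suc n)
  obtain M where M: "\<And>c :: nat list \<Rightarrow> nat. card (c ` PW b b M) \<le> r ^ b \<Longrightarrow>
    (\<exists>f\<in>PW b (b + n) M. \<forall>g\<in>PW b b n. \<forall>g'\<in>PW b b n.
       map (min e) g = map (min e) g' \<longrightarrow> c (sub b f g) = c (sub b f g'))"
    using Suc.IH[of "r ^ b"] by blast
  obtain ys where ys: "set ys = PW b b M" using finite_list[OF finite_PW] by blast
  \<comment> \<open>There are at most \<open>K\<close> colour vectors for the \<open>K + 1\<close>
    words \<open>p 0\<close>, ..., \<open>p K\<close>.\<close>
  define K where "K = r ^ length ys"
  have "\<exists>f\<in>PW b (b + Suc n) (M + K). \<forall>g\<in>PW b b (Suc n). \<forall>g'\<in>PW b b (Suc n).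
       map (min e) g = map (min e) g' \<longrightarrow> c (sub b f g) = c (sub b f g')"
    if c: "card (c ` PW b b (M + K)) \<le> r" for c :: "nat list \<Rightarrow> nat"
  proof -
    define p where "p j = replicate j e @ replicate (K - j) (Suc e)" for j
    have "card ((\<lambda>j. to_nat (map (\<lambda>y. c (y @ p j)) ys)) ` {..K}) \<le> K"
      unfolding K_def
    proof (rule card_image_vec[OF finite_PW c])
      fix j y assume "j \<in> {..r ^ length ys}" "y \<in> set ys"
      then show "y @ p j \<in> PW b b (M + K)" using ys by (auto simp: PW_def pw_same p_def b_def K_def)
    qed
    then have "\<not> inj_on (\<lambda>j. to_nat (map (\<lambda>y. c (y @ p j)) ys)) {..K}"
      by (intro pigeonhole) simp
    then obtain i j where ij: "i < j" "j \<le> K"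
      and eq: "to_nat (map (\<lambda>y. c (y @ p i)) ys) = to_nat (map (\<lambda>y. c (y @ p j)) ys)"
      unfolding inj_on_def by (metis atMost_iff linorder_neqE_nat)
    have eq: "c (y @ p i) = c (y @ p j)" if "y \<in> PW b b M" for y
      using vec_eqD[of c "\<lambda>y j. y @ p j" i ys j, OF eq] that ys by simp
    \<comment> \<open>The line through \<open>p i\<close> and \<open>p j\<close>; its moving block
      is the stretch on which the two words differ.\<close>
    define L where "L x = replicate i e @ replicate (j - i) x @ replicate (K - j) (Suc e)" for x
    have Lp: "L e = p j" "L (Suc e) = p i"
      using ij by (auto simp: L_def p_def replicate_add[symmetric] simp flip: append_assoc)
    have lenL: "length (L x) = K" for x using ij by (simp add: L_def)
    have Lw: "y @ L x \<in> PW b b (M + K)" if "y \<in> PW b b M" "x < b" for x y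
      using that lenL[of x] by (auto simp: PW_def pw_same L_def b_def)
    \<comment> \<open>Recording the colour for every letter \<open>x\<close> on the new line lets
      one \<open>f\<close> serve all last letters. This is why \<open>M\<close> was chosen for
      \<open>r ^ b\<close> colours.\<close>
    have "card ((\<lambda>y. to_nat (map (\<lambda>x. c (y @ L x)) [0..<b])) ` PW b b M) \<le> r ^ length [0..<b]"
      using Lw by (intro card_image_vec[OF finite_PW c]) auto
    then obtain f where f: "f \<in> PW b (b + n) M" and finv: "\<And>g g'. g\<in>PW b b n \<Longrightarrow> g'\<in>PW b b n \<Longrightarrow>
       map (min e) g = map (min e) g' \<Longrightarrow> to_nat (map (\<lambda>x. c (sub b f g @ L x)) [0..<b]) = to_nat (map (\<lambda>x. c (sub b f g' @ L x)) [0..<b])"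
      using M[of "\<lambda>y. to_nat (map (\<lambda>x. c (y @ L x)) [0..<b])"] by auto
    have "pw (b + n) (b + Suc n) (L (b + n))"
    proof -
      obtain d where "j - i = Suc d" using ij by (metis Suc_diff_Suc)
      moreover have "pw (b + n) (b + n) (replicate i e)" by (rule pw_replicate_const) (simp add: b_def)
      moreover have "pw (Suc (b + n)) (Suc (b + n)) (replicate d (b + n) @ replicate (K - j) (Suc e))"
        by (auto simp: pw_same b_def)
      ultimately show ?thesis unfolding L_def by (auto intro: pw_append)
    qed
    then have fL: "f @ L (b + n) \<in> PW b (b + Suc n) (M + K)"
      using f lenL by (auto simp: PW_def intro: pw_append)
    have sub: "sub b (f @ L (b + n)) (g @ [x]) = sub b f g @ L x" if "g \<in> PW b b n" "x < b" for g x
    proof -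
      have len: "length g = n" using that by (simp add: PW_def)
      have "(([0..<b] @ g) @ [x]) ! y = ([0..<b] @ g) ! y" if "y \<in> set f" for y
        using f len pw_less[OF _ that, of b "b + n"] by (subst nth_append) (simp add: PW_def)
      then have "sub b f (g @ [x]) = sub b f g" by (simp add: sub_def)
      moreover have "sub b (L (b + n)) (g @ [x]) = L x"
        using len by (auto simp: sub_def L_def b_def nth_append)
      ultimately show ?thesis by (simp add: sub_append)
    qed
    show ?thesis
    proof (intro bexI[OF _ fL] ballI impI)
      fix h h' assume h: "h \<in> PW b b (Suc n)" "h' \<in> PW b b (Suc n)" and hh: "map (min e) h = map (min e) h'"
      obtain g x where g: "h = g @ [x]" "g \<in> PW b b n" "x < b"
        using h(1) by (cases h rule: rev_cases) (auto simp: PW_def pw_same)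
      obtain g' x' where g': "h' = g' @ [x']" "g' \<in> PW b b n" "x' < b"
        using h(2) by (cases h' rule: rev_cases) (auto simp: PW_def pw_same)
      have m: "map (min e) g = map (min e) g'" "min e x = min e x'" using hh g g' by auto
      \<comment> \<open>The first \<open>n\<close> letters are exchanged by the choice of
        \<open>f\<close>, the last letter by the choice of the line.\<close>
      have "c (sub b f g @ L x) = c (sub b f g' @ L x)"
        using vec_eqD[of c "\<lambda>x y. y @ L x" "sub b f g" "[0..<b]" "sub b f g'" x, OF finv] g g' m by simp
      also have "\<dots> = c (sub b f g' @ L x')"
      proof (cases "x = x'")
        case False
        have "sub b f g' \<in> PW b b M" using f g' by (intro sub_PW) auto
        then have "c (sub b f g' @ L e) = c (sub b f g' @ L (Suc e))" using eq Lp by simp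
        moreover have "x = e \<and> x' = Suc e \<or> x = Suc e \<and> x' = e"
          using m g(3) g'(3) False by (auto simp: b_def min_def split: if_splits)
        ultimately show ?thesis by auto
      qed simp
      finally show "c (sub b (f @ L (b + n)) h) = c (sub b (f @ L (b + n)) h')"
        using sub g g' by simp
    qed
  qed
  then show ?case by blast
qed

text \<open>Induction on the alphabet: inside the subspace of Shelah's lemma the new letter
  \<open>Suc e\<close> may be replaced by \<open>e\<close> without changing the colour, so a line
  that is monochromatic for the old letters is so for the new one as well.\<close>

lemma hales_jewett_line:
  "\<exists>N. \<forall>c :: nat list \<Rightarrow> nat. card (c ` PW a a N) \<le> r \<longrightarrow>
    (\<exists>f\<in>PW a (Suc a) N. \<forall>x<a. \<forall>y<a. c (sub a f [x]) = c (sub a f [y]))"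
proof (induction a)
  case 0
  show ?case by (rule exI[of _ 1], auto simp: PW_def intro!: exI[of _ "[0]"])
next
  case (Suc a)
  show ?case
  \<comment> \<open>Shelah's lemma exchanges two letters; over a single letter there is nothing to
    compare.\<close>
  proof (cases a)
    case 0
    then show ?thesis
      by (intro exI[of _ 1]) (auto simp: PW_def intro!: exI[of _ "[Suc 0]"])
  next
    case a: (Suc e)
    let ?b = "Suc (Suc e)"
    obtain n where n: "\<And>c :: nat list \<Rightarrow> nat. card (c ` PW a a n) \<le> r \<Longrightarrow>
      \<exists>f\<in>PW a (Suc a) n. \<forall>x<a. \<forall>y<a. c (sub a f [x]) = c (sub a f [y])"
      using Suc.IH by blast
    obtain N where N: "\<And>c :: nat list \<Rightarrow> nat. card (c ` PW ?b ?b N) \<le> r \<Longrightarrow>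
      \<exists>f\<in>PW ?b (?b + n) N. \<forall>g\<in>PW ?b ?b n. \<forall>g'\<in>PW ?b ?b n.
       map (min e) g = map (min e) g' \<longrightarrow> c (sub ?b f g) = c (sub ?b f g')"
      using shelah[of e r n] by blast
    have "\<exists>f\<in>PW (Suc a) (Suc (Suc a)) N. \<forall>x<Suc a. \<forall>y<Suc a. c (sub (Suc a) f [x]) = c (sub (Suc a) f [y])"
      if c: "card (c ` PW (Suc a) (Suc a) N) \<le> r" for c :: "nat list \<Rightarrow> nat"
    proof -
      obtain f where f: "f \<in> PW ?b (?b + n) N" and inv: "\<And>g g'. g\<in>PW ?b ?b n \<Longrightarrow> g'\<in>PW ?b ?b n \<Longrightarrow>
       map (min e) g = map (min e) g' \<Longrightarrow> c (sub ?b f g) = c (sub ?b f g')"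
        using N[of c] c a by blast
      have aw: "PW a a n \<subseteq> PW ?b ?b n" using a by (auto simp: PW_def pw_same)
      have "(\<lambda>g. c (sub ?b f g)) ` PW a a n \<subseteq> c ` PW ?b ?b N"
        using sub_PW[OF f, of _ ?b] aw by auto
      then have "card ((\<lambda>g. c (sub ?b f g)) ` PW a a n) \<le> card (c ` PW ?b ?b N)"
        by (intro card_mono) auto
      with c a obtain l where l: "l \<in> PW a (Suc a) n"
        and lc: "\<And>x y. x < a \<Longrightarrow> y < a \<Longrightarrow> c (sub ?b f (sub a l [x])) = c (sub ?b f (sub a l [y]))"
        using n[of "\<lambda>g. c (sub ?b f g)"] by auto
      \<comment> \<open>The parameter of \<open>l\<close> has the number \<open>a\<close>, which is
        a letter of the larger alphabet; it is renumbered to \<open>?b\<close>.\<close>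
      define l' where "l' = sub a l [?b]"
      have l': "l' \<in> PW ?b (Suc ?b) n"
      proof -
        have "set [0..<a] \<subseteq> {..<?b}" using a by auto
        moreover have "pw ?b (Suc ?b) [?b]" by simp
        ultimately have "pw ?b (Suc ?b) (map ((!) ([0..<a] @ [?b])) l)"
          using l by (intro pw_map[of a "Suc a"]) (simp_all add: PW_def)
        then show ?thesis using l by (simp add: l'_def PW_def sub_def)
      qed
      have *: "sub ?b l' [x] = sub a l [x]" if "x < ?b" for x
      proof -
        have "([0..<?b] @ [x]) ! y = y" if "y < a" for y
          using that a by (subst nth_append) (simp del: upt_Suc)
        moreover have "([0..<?b] @ [x]) ! ?b = x" by (subst nth_append) simp
        ultimately have "map ((!) ([0..<?b] @ [x])) ([0..<a] @ [?b]) = [0..<a] @ [x]"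
          by (auto intro!: map_idI simp del: upt_Suc)
        then show ?thesis
          using map_nth_sub[OF l, of "[?b]" "[0..<?b] @ [x]"] by (simp add: l'_def sub_def del: upt_Suc)
      qed
      have xe: "c (sub ?b f (sub a l [x])) = c (sub ?b f (sub a l [e]))" if "x < ?b" for x
      proof (cases "x < a")
        case True
        then show ?thesis using lc[of x e] a by simp
      next
        case False
        then have "x = Suc e" using that a by simp
        moreover have "sub a l [Suc e] \<in> PW ?b ?b n"
          using *[of "Suc e"] sub_PW[OF l', of "[Suc e]" ?b] by (simp add: PW_def)
        moreover have "sub a l [e] \<in> PW ?b ?b n"
          using *[of "e"] sub_PW[OF l', of "[e]" ?b] by (simp add: PW_def)
        moreover have "map (min e) (sub a l [Suc e]) = map (min e) (sub a l [e])"
        proof -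
          have "y < a \<or> y = a" if "y \<in> set l" for y
            using pw_less[OF _ that, of a "Suc a"] l by (auto simp: PW_def)
          then show ?thesis by (fastforce simp: sub_def nth_append)
        qed
        ultimately show ?thesis using inv by blast
      qed
      have F: "sub ?b f l' \<in> PW ?b (Suc ?b) N" using f l' by (intro sub_PW) auto
      have "c (sub ?b (sub ?b f l') [x]) = c (sub ?b f (sub a l [e]))" if "x < ?b" for x
      proof -
        have "sub ?b (sub ?b f l') [x] = sub ?b f (sub a l [x])"
          using sub_assoc[OF f, of l' "[x]"] l' *[OF that] by (simp add: PW_def)
        then show ?thesis using xe[OF that] by (rule ssubst)
      qed
      then show ?thesis using F unfolding a by (metis (no_types))
    qed
    then show ?thesis by blast
  qed
qed

section \<open>The Graham-Rothschild theorem\<close>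

text \<open>\<open>t\<close> counts the parameters of the coloured words and \<open>m\<close> those
  of the subspace \<open>f\<close>. The case \<open>t = 0\<close> is the multidimensional
  Hales-Jewett theorem, the case \<open>a = 0\<close> the dual Ramsey theorem.\<close>

definition GR :: "nat \<Rightarrow> nat \<Rightarrow> bool" where
  "GR a t \<longleftrightarrow> (\<forall>m r. \<exists>N. \<forall>c :: nat list \<Rightarrow> nat. card (c ` PW a (a + t) N) \<le> r \<longrightarrow>
     (\<exists>f\<in>PW a (a + m) N. \<exists>j. \<forall>g\<in>PW a (a + t) m. c (sub a f g) = j))"

lemma pw_upt: "pw a (a + n) [a..<a + n]"
proof (induction n)
  case (Suc n)
  then have "pw a (Suc (a + n)) ([a..<a + n] @ [a + n])" by (rule pw_append) simp
  then show ?case by simp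
qed simp

text \<open>One line is appended per dimension. It is chosen for the product colouring over all
  words of length \<open>M\<close>, so its letter is irrelevant whatever precedes it, and the
  induction hypothesis is applied with the letter \<open>0\<close> on the line.\<close>

lemma GR_0: "GR a 0"
proof -
  have "\<exists>N. \<forall>c :: nat list \<Rightarrow> nat. card (c ` PW a a N) \<le> r \<longrightarrow>
     (\<exists>f\<in>PW a (a + m) N. \<exists>j. \<forall>g\<in>PW a a m. c (sub a f g) = j)" for m r
  proof (induction m)
    case 0
    show ?case by (rule exI[of _ 0]) (auto simp: PW_def)
  next
    case (Suc m)
    show ?case
    \<comment> \<open>Over the empty alphabet no word of positive length is coloured, and there is
      no letter \<open>0\<close> to put on a line.\<close>
    proof (cases "a = 0")
      case True
      have "PW 0 0 (Suc m) = {}" by (auto simp: PW_def pw_same)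
      moreover have "[0..<Suc m] \<in> PW 0 (Suc m) (Suc m)"
        using pw_upt[of 0 "Suc m"] by (simp add: PW_def)
      ultimately show ?thesis using True by auto
    next
      case a: False
      obtain M where M: "\<And>c :: nat list \<Rightarrow> nat. card (c ` PW a a M) \<le> r \<Longrightarrow>
        \<exists>f\<in>PW a (a + m) M. \<exists>j. \<forall>g\<in>PW a a m. c (sub a f g) = j"
        using Suc.IH by blast
      obtain ys where ys: "set ys = PW a a M" using finite_list[OF finite_PW] by blast
      obtain K where K: "\<And>c :: nat list \<Rightarrow> nat. card (c ` PW a a K) \<le> r ^ length ys \<Longrightarrow>
        \<exists>f\<in>PW a (Suc a) K. \<forall>x<a. \<forall>y<a. c (sub a f [x]) = c (sub a f [y])"
        using hales_jewett_line[of a "r ^ length ys"] by blast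
      have "\<exists>f\<in>PW a (a + Suc m) (M + K). \<exists>j. \<forall>g\<in>PW a a (Suc m). c (sub a f g) = j"
        if c: "card (c ` PW a a (M + K)) \<le> r" for c :: "nat list \<Rightarrow> nat"
      proof -
        have "card ((\<lambda>w. to_nat (map (\<lambda>y. c (y @ w)) ys)) ` PW a a K) \<le> r ^ length ys"
          using ys by (intro card_image_vec[OF finite_PW c]) (auto simp: PW_def intro: pw_append)
        then obtain l where l: "l \<in> PW a (Suc a) K"
          and lc: "\<forall>x<a. \<forall>y<a. to_nat (map (\<lambda>z. c (z @ sub a l [x])) ys) = to_nat (map (\<lambda>z. c (z @ sub a l [y])) ys)"
          using K by blast
        have lc: "c (z @ sub a l [x]) = c (z @ sub a l [y])" if "x < a" "y < a" "z \<in> PW a a M" for x y z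
          using lc[rule_format, OF that(1,2)] that(3) ys by (intro vec_eqD[of c "\<lambda>z w. z @ w"]) auto
        have lw: "sub a l [x] \<in> PW a a K" if "x < a" for x
          using that by (intro sub_PW[OF l]) (simp add: PW_def)
        have "(\<lambda>z. c (z @ sub a l [0])) ` PW a a M \<subseteq> c ` PW a a (M + K)"
          using lw[of 0] a by (auto simp: PW_def intro: pw_append)
        then have "card ((\<lambda>z. c (z @ sub a l [0])) ` PW a a M) \<le> r"
          using c by (meson card_mono finite_PW finite_imageI le_trans)
        from M[OF this] obtain f j where f: "f \<in> PW a (a + m) M"
          and fc: "\<And>g. g \<in> PW a a m \<Longrightarrow> c (sub a f g @ sub a l [0]) = j" by blast
        define l' where "l' = sub a l [a + m]"
        have "set [0..<a] \<subseteq> {..<a + m}" by auto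
        then have "pw (a + m) (Suc (a + m)) (map ((!) ([0..<a] @ [a + m])) l)"
          using l by (intro pw_map[of a "Suc a"]) (simp_all add: PW_def)
        then have l': "l' \<in> PW (a + m) (Suc (a + m)) K" using l by (simp add: l'_def PW_def sub_def)
        have fl: "f @ l' \<in> PW a (a + Suc m) (M + K)"
          using f l' by (auto simp: PW_def intro: pw_append)
        have "c (sub a (f @ l') h) = j" if h: "h \<in> PW a a (Suc m)" for h
        proof -
          obtain g x where g: "h = g @ [x]" "g \<in> PW a a m" "x < a"
            using h by (cases h rule: rev_cases) (auto simp: PW_def pw_same)
          have len: "length g = m" using g by (simp add: PW_def)
          have "(([0..<a] @ g) @ [x]) ! y = ([0..<a] @ g) ! y" if "y \<in> set f" for y
            using f len pw_less[OF _ that, of a "a + m"] by (subst nth_append) (simp add: PW_def)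
          then have 1: "sub a f h = sub a f g" by (simp add: sub_def g)
          have "map ((!) ([0..<a] @ h)) ([0..<a] @ [a + m]) = [0..<a] @ [x]"
            using len g(1) by (auto simp: nth_append intro!: nth_equalityI)
          then have 2: "sub a l' h = sub a l [x]"
            using map_nth_sub[OF l, of "[a + m]" "[0..<a] @ h"] by (simp add: l'_def sub_def)
          have "sub a f g \<in> PW a a M" using f g by (intro sub_PW) auto
          then have "c (sub a f g @ sub a l [x]) = c (sub a f g @ sub a l [0])"
            using lc g a by blast
          then show ?thesis using 1 2 fc g by (simp add: sub_append)
        qed
        then show ?thesis using fl by blast
      qed
      then show ?thesis by blast
    qed
  qed
  then show ?thesis by (simp add: GR_def)
qed

section \<open>Raising the number of parameters\<close>

lemma shift_PW:
  assumes "h \<in> PW a (a + m) n"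
  shows "sub a h [Suc a..<Suc a + m] \<in> PW (Suc a) (Suc a + m) n"
proof -
  have "set [0..<a] \<subseteq> {..<Suc a}" by auto
  then have "pw (Suc a) (Suc a + m) (map ((!) ([0..<a] @ [Suc a..<Suc a + m])) h)"
    using assms by (intro pw_map[of a "a + m"] pw_upt) (simp_all add: PW_def)
  then show ?thesis using assms by (simp add: PW_def sub_def)
qed

text \<open>The shifted word avoids the letter \<open>a\<close>, so the entry \<open>l\<close> of
  the table is never read.\<close>

lemma map_nth_shift:
  assumes "h \<in> PW a (a + m) n" "length g = m"
  shows "map ((!) ([0..<a] @ l # g)) (sub a h [Suc a..<Suc a + m]) = sub a h g"
proof -
  have "map ((!) ([0..<a] @ l # g)) ([0..<a] @ [Suc a..<Suc a + m]) = [0..<a] @ g"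
    using assms(2) by (auto simp: nth_append nth_Cons' simp del: upt_Suc intro!: nth_equalityI)
  then show ?thesis
    using map_nth_sub[OF assms(1), of "[Suc a..<Suc a + m]" "[0..<a] @ l # g"]
    by (simp add: sub_def del: upt_Suc)
qed

text \<open>Induction on \<open>M\<close>, by the first letter of \<open>g\<close>. If that is the
  first parameter, a word over one more constant follows, and \<open>GR (Suc a) t\<close> settles
  the colour. If it is a constant \<open>l\<close>, the induction hypothesis handles the rest, for
  all \<open>l\<close> at once by a product colouring.\<close>

lemma GR_prefix_dependence:
  assumes "GR (Suc a) t"
  shows "\<exists>N. \<forall>c :: nat list \<Rightarrow> nat. card (c ` PW a (a + Suc t) N) \<le> r \<longrightarrow>
    (\<exists>f\<in>PW a (a + M) N. \<forall>g\<in>PW a (a + Suc t) M. \<forall>g'\<in>PW a (a + Suc t) M.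
       takeWhile (\<lambda>x. x < a) g = takeWhile (\<lambda>x. x < a) g' \<longrightarrow> c (sub a f g) = c (sub a f g'))"
proof (induction M arbitrary: r)
  case 0
  show ?case by (rule exI[of _ 0]) (auto simp: PW_def)
next
  case (Suc M)
  obtain N2 where N2: "\<And>c :: nat list \<Rightarrow> nat. card (c ` PW a (a + Suc t) N2) \<le> r ^ a \<Longrightarrow>
    (\<exists>f\<in>PW a (a + M) N2. \<forall>g\<in>PW a (a + Suc t) M. \<forall>g'\<in>PW a (a + Suc t) M.
       takeWhile (\<lambda>x. x < a) g = takeWhile (\<lambda>x. x < a) g' \<longrightarrow> c (sub a f g) = c (sub a f g'))"
    using Suc.IH[of "r ^ a"] by blast
  obtain N1 where N1: "\<And>c :: nat list \<Rightarrow> nat. card (c ` PW (Suc a) (Suc a + t) N1) \<le> r \<Longrightarrow>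
     \<exists>f\<in>PW (Suc a) (Suc a + N2) N1. \<exists>j. \<forall>g\<in>PW (Suc a) (Suc a + t) N2. c (sub (Suc a) f g) = j"
    using assms unfolding GR_def by metis
  have "\<exists>f\<in>PW a (a + Suc M) (Suc N1). \<forall>g\<in>PW a (a + Suc t) (Suc M). \<forall>g'\<in>PW a (a + Suc t) (Suc M).
       takeWhile (\<lambda>x. x < a) g = takeWhile (\<lambda>x. x < a) g' \<longrightarrow> c (sub a f g) = c (sub a f g')"
    if c: "card (c ` PW a (a + Suc t) (Suc N1)) \<le> r" for c :: "nat list \<Rightarrow> nat"
  proof -
    have "(\<lambda>w. c (a # w)) ` PW (Suc a) (Suc a + t) N1 \<subseteq> c ` PW a (a + Suc t) (Suc N1)"
      by (auto simp: PW_def)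
    then have "card ((\<lambda>w. c (a # w)) ` PW (Suc a) (Suc a + t) N1) \<le> r"
      using c by (meson card_mono finite_PW finite_imageI le_trans)
    from N1[OF this] obtain f j where f: "f \<in> PW (Suc a) (Suc a + N2) N1"
      and fj: "\<And>g. g \<in> PW (Suc a) (Suc a + t) N2 \<Longrightarrow> c (a # sub (Suc a) f g) = j" by blast
    \<comment> \<open>In \<open>f\<close> the letter \<open>a\<close> repeats the leading parameter;
      \<open>F l w\<close> is what remains when this parameter receives the constant
      \<open>l\<close>.\<close>
    define F where "F l w = map ((!) (([0..<a] @ [l]) @ w)) f" for l w
    have F: "l # F l w \<in> PW a (a + Suc t) (Suc N1)" if "l < a" "w \<in> PW a (a + Suc t) N2" for l w
    proof -
      have "set ([0..<a] @ [l]) \<subseteq> {..<a}" using that by auto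
      then have "pw a (a + Suc t) (F l w)" unfolding F_def
        using f that by (intro pw_map[of "Suc a" "Suc a + N2"]) (simp_all add: PW_def)
      then show ?thesis using that f by (simp add: PW_def F_def)
    qed
    have "card ((\<lambda>w. to_nat (map (\<lambda>l. c (l # F l w)) [0..<a])) ` PW a (a + Suc t) N2) \<le> r ^ length [0..<a]"
      using F by (intro card_image_vec[OF finite_PW c]) auto
    then obtain h where h: "h \<in> PW a (a + M) N2"
      and hc: "\<forall>g\<in>PW a (a + Suc t) M. \<forall>g'\<in>PW a (a + Suc t) M.
       takeWhile (\<lambda>x. x < a) g = takeWhile (\<lambda>x. x < a) g' \<longrightarrow>
         to_nat (map (\<lambda>l. c (l # F l (sub a h g))) [0..<a]) = to_nat (map (\<lambda>l. c (l # F l (sub a h g'))) [0..<a])"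
      using N2[of "\<lambda>w. to_nat (map (\<lambda>l. c (l # F l w)) [0..<a])"] by auto
    define h' where "h' = sub a h [Suc a..<Suc a + M]"
    have h': "h' \<in> PW (Suc a) (Suc a + M) N2" unfolding h'_def by (rule shift_PW[OF h])
    \<comment> \<open>The new subspace begins with its first parameter, so the first letter of the
      inserted word is also the first letter of the result.\<close>
    have f': "a # sub (Suc a) f h' \<in> PW a (a + Suc M) (Suc N1)"
      using sub_PW[OF f, of h' "Suc a + M"] h' by (simp add: PW_def)
    have F_sub: "sub a (a # sub (Suc a) f h') (l # g) = l # F l (sub a h g)" if "length g = M" for l g
    proof -
      have "map ((!) ([0..<a] @ l # g)) ([0..<Suc a] @ h') = ([0..<a] @ [l]) @ sub a h g"
        using map_nth_shift[OF h that, of l] by (auto simp: h'_def nth_append intro!: nth_equalityI)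
      then show ?thesis
        using map_nth_sub[OF f, of h' "[0..<a] @ l # g"] h'
        by (simp add: sub_def[of a "_ # _"] F_def PW_def nth_append)
    qed
    show ?thesis
    proof (intro bexI[OF _ f'] ballI impI)
      fix k k' assume k: "k \<in> PW a (a + Suc t) (Suc M)" "k' \<in> PW a (a + Suc t) (Suc M)"
        and kk: "takeWhile (\<lambda>x. x < a) k = takeWhile (\<lambda>x. x < a) k'"
      obtain l g where g: "k = l # g" "length g = M" using k by (cases k) (auto simp: PW_def)
      obtain l' g' where g': "k' = l' # g'" "length g' = M" using k by (cases k') (auto simp: PW_def)
      show "c (sub a (a # sub (Suc a) f h') k) = c (sub a (a # sub (Suc a) f h') k')"
      proof (cases "l < a")
        case True
        then have l: "l' = l" "takeWhile (\<lambda>x. x < a) g = takeWhile (\<lambda>x. x < a) g'"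
          using kk g g' by (auto split: if_splits)
        have "g \<in> PW a (a + Suc t) M" "g' \<in> PW a (a + Suc t) M"
          using True l k g g' by (auto simp: PW_def)
        with hc l have "to_nat (map (\<lambda>l. c (l # F l (sub a h g))) [0..<a]) = to_nat (map (\<lambda>l. c (l # F l (sub a h g'))) [0..<a])"
          by blast
        then have "c (l # F l (sub a h g)) = c (l # F l (sub a h g'))" using True by simp
        then show ?thesis using F_sub g g' l by simp
      next
        case False
        \<comment> \<open>The words with empty constant prefix: all of them have the colour
          \<open>j\<close> found by \<open>GR (Suc a) t\<close>.\<close>
        have *: "c (sub a (a # sub (Suc a) f h') (i # u)) = j"
          if "i # u \<in> PW a (a + Suc t) (Suc M)" "\<not> i < a" for i u
        proof -
          have i: "i = a" and u: "u \<in> PW (Suc a) (Suc a + t) M" using that by (auto simp: PW_def)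
          have "sub a (a # sub (Suc a) f h') (a # u) = a # sub (Suc a) (sub (Suc a) f h') u"
            by (simp add: sub_def nth_append)
          also have "\<dots> = a # sub (Suc a) f (sub (Suc a) h' u)"
            using h' by (subst sub_assoc[OF f]) (simp_all add: PW_def)
          finally show ?thesis
            using fj[of "sub (Suc a) h' u"] sub_PW[OF h', of u] u i by simp
        qed
        have "\<not> l' < a" using False kk g g' by (auto split: if_splits)
        then show ?thesis using * False k g g' by simp
      qed
    qed
  qed
  then show ?case by blast
qed

lemma pw_Suc_split:
  assumes "pw a (Suc a) w"
  obtains u v where "w = u @ a # v" "set u \<subseteq> {..<a}"
proof -
  have "\<exists>u v. w = u @ a # v \<and> set u \<subseteq> {..<a}" using assms
  proof (induction w)
    case (Cons y w)
    show ?case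
    proof (cases "y < a")
      case True
      with Cons obtain u v where "w = u @ a # v" "set u \<subseteq> {..<a}" by auto
      then show ?thesis using True by (intro exI[of _ "y # u"] exI[of _ v]) auto
    next
      case False
      with Cons.prems have "y = a" by simp
      then show ?thesis by (intro exI[of _ "[]"] exI[of _ w]) simp
    qed
  qed simp
  then show ?thesis using that by blast
qed

text \<open>Hales-Jewett lines are put in front one by one. A constant as first letter may be
  changed to \<open>0\<close> without affecting the colour; otherwise the prefix stops inside the
  first line, where its parameter first occurs, and is a fixed word. Entries of \<open>g\<close>
  from \<open>a\<close> on merely mark the end of the prefix.\<close>

lemma prefix_length_dependence:
  assumes a: "a > 0"
  shows "\<exists>M. \<forall>d :: nat list \<Rightarrow> nat. card (d ` {w. set w \<subseteq> {..<a} \<and> length w \<le> M}) \<le> r \<longrightarrow>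
    (\<exists>q\<in>PW a (a + m) M. \<forall>g g'. length g = m \<longrightarrow> length g' = m \<longrightarrow>
       length (takeWhile (\<lambda>x. x < a) g) = length (takeWhile (\<lambda>x. x < a) g') \<longrightarrow>
       length (takeWhile (\<lambda>x. x < a) g) < m \<longrightarrow>
       d (takeWhile (\<lambda>x. x < a) (sub a q g)) = d (takeWhile (\<lambda>x. x < a) (sub a q g')))"
proof (induction m)
  case 0
  show ?case by (rule exI[of _ 0]) (auto simp: PW_def)
next
  case (Suc m)
  let ?W = "\<lambda>M. {w. set w \<subseteq> {..<a} \<and> length w \<le> M}"
  let ?tw = "takeWhile (\<lambda>x. x < a)"
  have fin: "finite (?W n)" for n by (simp add: finite_lists_length_le)
  obtain M where M: "\<And>d :: nat list \<Rightarrow> nat. card (d ` ?W M) \<le> r \<Longrightarrow>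
    (\<exists>q\<in>PW a (a + m) M. \<forall>g g'. length g = m \<longrightarrow> length g' = m \<longrightarrow>
       length (?tw g) = length (?tw g') \<longrightarrow> length (?tw g) < m \<longrightarrow> d (?tw (sub a q g)) = d (?tw (sub a q g')))"
    using Suc.IH by blast
  obtain ys where ys: "set ys = ?W M" using finite_list[OF fin] by blast
  obtain K where K: "\<And>c :: nat list \<Rightarrow> nat. card (c ` PW a a K) \<le> r ^ length ys \<Longrightarrow>
    \<exists>f\<in>PW a (Suc a) K. \<forall>x<a. \<forall>y<a. c (sub a f [x]) = c (sub a f [y])"
    using hales_jewett_line[of a "r ^ length ys"] by blast
  have "\<exists>q\<in>PW a (a + Suc m) (K + M). \<forall>g g'. length g = Suc m \<longrightarrow> length g' = Suc m \<longrightarrow>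
       length (?tw g) = length (?tw g') \<longrightarrow> length (?tw g) < Suc m \<longrightarrow> d (?tw (sub a q g)) = d (?tw (sub a q g'))"
    if d: "card (d ` ?W (K + M)) \<le> r" for d :: "nat list \<Rightarrow> nat"
  proof -
    have "card ((\<lambda>w. to_nat (map (\<lambda>y. d (w @ y)) ys)) ` PW a a K) \<le> r ^ length ys"
      using ys by (intro card_image_vec[OF fin d]) (auto simp: PW_def pw_same)
    then obtain l where l: "l \<in> PW a (Suc a) K"
      and lc: "\<forall>x<a. \<forall>y<a. to_nat (map (\<lambda>z. d (sub a l [x] @ z)) ys) = to_nat (map (\<lambda>z. d (sub a l [y] @ z)) ys)"
      using K by blast
    have lc: "d (sub a l [x] @ z) = d (sub a l [y] @ z)" if "x < a" "y < a" "z \<in> ?W M" for x y z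
      using lc[rule_format, OF that(1,2)] that(3) ys by (intro vec_eqD[of d "\<lambda>z w. w @ z"]) auto
    have lw: "sub a l [x] \<in> PW a a K" if "x < a" for x
      using that by (intro sub_PW[OF l]) (simp add: PW_def)
    have "(\<lambda>z. d (sub a l [0] @ z)) ` ?W M \<subseteq> d ` ?W (K + M)"
      using lw[OF a] by (auto simp: PW_def pw_same)
    then have "card ((\<lambda>z. d (sub a l [0] @ z)) ` ?W M) \<le> r"
      by (intro order_trans[OF card_mono d] finite_imageI fin)
    from M[OF this] obtain q where q: "q \<in> PW a (a + m) M"
      and qd: "\<And>g g'. length g = m \<Longrightarrow> length g' = m \<Longrightarrow>
       length (?tw g) = length (?tw g') \<Longrightarrow> length (?tw g) < m \<Longrightarrow>
       d (sub a l [0] @ ?tw (sub a q g)) = d (sub a l [0] @ ?tw (sub a q g'))" by blast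
    define q' where "q' = sub a q [Suc a..<Suc a + m]"
    have "q' \<in> PW (Suc a) (Suc a + m) M" unfolding q'_def by (rule shift_PW[OF q])
    then have lq: "l @ q' \<in> PW a (a + Suc m) (K + M)"
      using l by (auto simp: PW_def intro: pw_append)
    have sub_lq: "sub a (l @ q') (x # g) = sub a l [x] @ sub a q g" if "length g = m" for x g
    proof -
      have "([0..<a] @ x # g) ! y = ([0..<a] @ [x]) ! y" if "y \<in> set l" for y
        using l pw_less[OF _ that, of a "Suc a"] by (auto simp: PW_def nth_append less_Suc_eq)
      then have "sub a l (x # g) = sub a l [x]" by (simp add: sub_def)
      moreover have "sub a q' (x # g) = sub a q g"
        using map_nth_shift[OF q that] by (simp add: q'_def sub_def)
      ultimately show ?thesis by (simp add: sub_append)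
    qed
    \<comment> \<open>\<open>u\<close> is this fixed word: the whole prefix whenever the first
      letter is no constant.\<close>
    obtain u v where uv: "l = u @ a # v" "set u \<subseteq> {..<a}" using l pw_Suc_split[of a l] by (auto simp: PW_def)
    have lx: "?tw (sub a l [x] @ w) = u" if "\<not> x < a" for x w
    proof -
      have "map ((!) ([0..<a] @ [x])) u = u"
        using uv(2) by (intro map_idI) (auto simp: nth_append)
      then show ?thesis using that uv by (simp add: sub_def nth_append takeWhile_append subset_iff)
    qed
    show ?thesis
    proof (intro bexI[OF _ lq] allI impI)
      fix h h' :: "nat list" assume "length h = Suc m" "length h' = Suc m"
        and tw: "length (?tw h) = length (?tw h')" "length (?tw h) < Suc m"
      then obtain x g x' g' where g: "h = x # g" "length g = m" and g': "h' = x' # g'" "length g' = m"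
        by (metis length_Suc_conv)
      show "d (?tw (sub a (l @ q') h)) = d (?tw (sub a (l @ q') h'))"
      proof (cases "x < a")
        case True
        then have x': "x' < a" and tw': "length (?tw g) = length (?tw g')" "length (?tw g) < m"
          using tw g g' by (auto split: if_splits)
        have *: "d (?tw (sub a (l @ q') (y # k))) = d (sub a l [0] @ ?tw (sub a q k))"
          if "y < a" "length k = m" for y k
        proof -
          have "?tw (sub a l [y] @ sub a q k) = sub a l [y] @ ?tw (sub a q k)"
            using lw[OF that(1)] by (intro takeWhile_append2) (auto simp: PW_def pw_same)
          moreover have "?tw (sub a q k) \<in> ?W M"
            using q length_takeWhile_le[of _ "sub a q k"] set_takeWhileD[of _ _ "sub a q k"] by (auto simp: PW_def)
          ultimately show ?thesis using lc[of y 0 "?tw (sub a q k)"] that a sub_lq by simp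
        qed
        show ?thesis using *[OF True g(2)] *[OF x' g'(2)] qd[OF g(2) g'(2) tw'] g(1) g'(1) by simp
      next
        case False
        then have "\<not> x' < a" using tw g g' by (auto split: if_splits)
        then show ?thesis using False lx sub_lq g g' by simp
      qed
    qed
  qed
  then show ?case by blast
qed

lemma takeWhile_append_short:
  "length (takeWhile P xs) < length xs \<Longrightarrow> takeWhile P (xs @ ys) = takeWhile P xs"
  by (induction xs) auto

text \<open>The word constructed has the parameters, once each, at the positions in \<open>J\<close>
  and the constant \<open>0\<close> elsewhere. Hence the first letter of \<open>sub a p g\<close>
  that is no constant stands at a position in \<open>J\<close>.\<close>

lemma PW_selecting_positions:
  assumes "a > 0" "J \<subseteq> {..<n}" "card J = m"
  shows "\<exists>p\<in>PW a (a + m) n. \<forall>g. length g = m \<longrightarrow> length (takeWhile (\<lambda>x. x < a) g) < m \<longrightarrow>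
    length (takeWhile (\<lambda>x. x < a) (sub a p g)) \<in> J"
  using assms(2,3)
proof (induction n arbitrary: m J)
  case 0
  then show ?case by (auto simp: PW_def)
next
  case (Suc n)
  let ?tw = "takeWhile (\<lambda>x. x < a)"
  show ?case
  proof (cases "n \<in> J")
    case True
    have "finite J" using Suc.prems(1) finite_subset by blast
    then obtain k where m: "m = Suc k" and k: "card (J - {n}) = k" using True Suc.prems(2)
      by (cases m) auto
    have J: "J - {n} \<subseteq> {..<n}" using Suc.prems(1) by (auto simp: less_Suc_eq)
    obtain p where p: "p \<in> PW a (a + k) n"
      and pJ: "\<And>g. length g = k \<Longrightarrow> length (?tw g) < k \<Longrightarrow> length (?tw (sub a p g)) \<in> J - {n}"
      using Suc.IH[OF J k] by blast
    have "length (?tw (sub a (p @ [a + k]) h)) \<in> J"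
      if len: "length h = m" and tw: "length (?tw h) < m" for h
    proof -
      obtain g x where g: "h = g @ [x]" "length g = k"
        using len m by (cases h rule: rev_cases) auto
      have "(([0..<a] @ g) @ [x]) ! y = ([0..<a] @ g) ! y" if "y \<in> set p" for y
        using p g pw_less[OF _ that, of a "a + k"] by (subst nth_append) (simp add: PW_def)
      then have s: "sub a (p @ [a + k]) h = sub a p g @ [x]"
        using g by (simp add: sub_def nth_append)
      show ?thesis
      proof (cases "length (?tw g) < k")
        case True
        then have "length (?tw (sub a p g)) \<in> J - {n}" using pJ g by blast
        moreover from this have "length (?tw (sub a p g)) < length (sub a p g)"
          using J p by (auto simp: PW_def)
        ultimately show ?thesis using s takeWhile_append_short by (metis DiffD1)
      next
        case False
        then have "length (?tw g) = length g" using g length_takeWhile_le[of _ g] by (metis linorder_neqE_nat not_less)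
        then have ga: "set g \<subseteq> {..<a}" by (metis lessThan_iff set_takeWhileD subsetI takeWhile_eq_take take_all le_refl)
        then have "g \<in> PW a a k" using g by (simp add: PW_def pw_same)
        then have "sub a p g \<in> PW a a n" using p by (intro sub_PW) auto
        moreover have "\<not> x < a" using tw g ga m by (auto simp: takeWhile_append subset_iff split: if_splits)
        ultimately have "?tw (sub a p g @ [x]) = sub a p g"
          by (auto simp: PW_def pw_same takeWhile_append subset_iff)
        then show ?thesis using s True p by (simp add: PW_def)
      qed
    qed
    moreover have "p @ [a + k] \<in> PW a (a + m) (Suc n)" using p m by (auto simp: PW_def intro: pw_append)
    ultimately show ?thesis by blast
  next
    case False
    then have J: "J \<subseteq> {..<n}" using Suc.prems(1) by (auto simp: less_Suc_eq)
    obtain p where p: "p \<in> PW a (a + m) n"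
      and pJ: "\<And>g. length g = m \<Longrightarrow> length (?tw g) < m \<Longrightarrow> length (?tw (sub a p g)) \<in> J"
      using Suc.IH[OF J Suc.prems(2)] by blast
    have "length (?tw (sub a (p @ [0]) g)) \<in> J" if "length g = m" "length (?tw g) < m" for g
    proof -
      have "length (?tw (sub a p g)) \<in> J" using pJ that by blast
      moreover from this have "length (?tw (sub a p g)) < length (sub a p g)"
        using J p by (auto simp: PW_def)
      ultimately show ?thesis by (metis sub_append takeWhile_append_short)
    qed
    moreover have "p @ [0] \<in> PW a (a + m) (Suc n)"
      using p assms(1) by (auto simp: PW_def intro!: pw_append)
    ultimately show ?thesis by blast
  qed
qed

text \<open>After \<open>f\<close> only the constant prefix matters, after \<open>q\<close> only its
  length, and \<open>p\<close> confines the length to a set of positions with equal colour. The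
  composition of the three is the required word.\<close>

lemma GR_Suc:
  assumes "GR (Suc a) t"
  shows "GR a (Suc t)"
  unfolding GR_def
proof (intro allI)
  fix m r :: nat
  let ?tw = "takeWhile (\<lambda>x. x < a)"
  note S1 = GR_prefix_dependence[OF assms]
  show "\<exists>N. \<forall>c :: nat list \<Rightarrow> nat. card (c ` PW a (a + Suc t) N) \<le> r \<longrightarrow>
     (\<exists>f\<in>PW a (a + m) N. \<exists>j. \<forall>g\<in>PW a (a + Suc t) m. c (sub a f g) = j)"
  proof (cases "a = 0")
    case True
    \<comment> \<open>Without constants the prefix is always empty, so dependence on the prefix
      alone means constancy.\<close>
    then have tw: "?tw g = []" for g by (cases g) auto
    show ?thesis using S1[of r m] unfolding tw by metis
  next
    case False
    then have a: "a > 0" by simp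
    \<comment> \<open>Among \<open>m * Suc r\<close> lengths in at most \<open>Suc r\<close>
      colours, some colour occurs at least \<open>m\<close> times.\<close>
    define n where "n = m * Suc r"
    let ?W = "\<lambda>M. {w. set w \<subseteq> {..<a} \<and> length w \<le> M}"
    obtain M where M: "\<And>d :: nat list \<Rightarrow> nat. card (d ` ?W M) \<le> Suc r \<Longrightarrow>
      (\<exists>q\<in>PW a (a + n) M. \<forall>g g'. length g = n \<longrightarrow> length g' = n \<longrightarrow>
       length (?tw g) = length (?tw g') \<longrightarrow> length (?tw g) < n \<longrightarrow> d (?tw (sub a q g)) = d (?tw (sub a q g')))"
      using prefix_length_dependence[OF a, of "Suc r" n] by blast
    obtain N where N: "\<And>c :: nat list \<Rightarrow> nat. card (c ` PW a (a + Suc t) N) \<le> r \<Longrightarrow>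
      (\<exists>f\<in>PW a (a + M) N. \<forall>g\<in>PW a (a + Suc t) M. \<forall>g'\<in>PW a (a + Suc t) M.
       ?tw g = ?tw g' \<longrightarrow> c (sub a f g) = c (sub a f g'))"
      using S1[of r M] by blast
    have "\<exists>f\<in>PW a (a + m) N. \<exists>j. \<forall>g\<in>PW a (a + Suc t) m. c (sub a f g) = j"
      if c: "card (c ` PW a (a + Suc t) N) \<le> r" for c :: "nat list \<Rightarrow> nat"
    proof -
      obtain f where f: "f \<in> PW a (a + M) N"
        and fc: "\<And>g g'. g \<in> PW a (a + Suc t) M \<Longrightarrow> g' \<in> PW a (a + Suc t) M \<Longrightarrow>
          ?tw g = ?tw g' \<Longrightarrow> c (sub a f g) = c (sub a f g')"
        using N[OF c] by blast
      \<comment> \<open>\<open>Suc\<close> reserves \<open>0\<close> for words that are no constant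
        prefix of a word in \<open>PW a (a + Suc t) M\<close>; this is the additional colour in
        \<open>Suc r\<close>.\<close>
      define d where "d w = (if \<exists>g\<in>PW a (a + Suc t) M. ?tw g = w
        then Suc (c (sub a f (SOME g. g \<in> PW a (a + Suc t) M \<and> ?tw g = w))) else 0)" for w
      have d: "d (?tw g) = Suc (c (sub a f g))" if "g \<in> PW a (a + Suc t) M" for g
      proof -
        let ?s = "SOME g'. g' \<in> PW a (a + Suc t) M \<and> ?tw g' = ?tw g"
        have "?s \<in> PW a (a + Suc t) M \<and> ?tw ?s = ?tw g" by (rule someI[of _ g]) (use that in auto)
        then show ?thesis using that fc[of ?s g] by (auto simp: d_def)
      qed
      have "d ` ?W M \<subseteq> insert 0 (Suc ` c ` PW a (a + Suc t) N)"
      proof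
        fix y assume "y \<in> d ` ?W M"
        then obtain w where "y = d w" by blast
        then show "y \<in> insert 0 (Suc ` c ` PW a (a + Suc t) N)"
        proof (cases "\<exists>g\<in>PW a (a + Suc t) M. ?tw g = w")
          case True
          then obtain g where "g \<in> PW a (a + Suc t) M" "?tw g = w" by blast
          then show ?thesis using \<open>y = d w\<close> d[of g] sub_PW[OF f, of g "a + Suc t"] by auto
        next
          case False
          then have "y = 0" using \<open>y = d w\<close> unfolding d_def by (simp only: if_False)
          then show ?thesis by simp
        qed
      qed
      then have "card (d ` ?W M) \<le> card (insert 0 (Suc ` c ` PW a (a + Suc t) N))"
        by (intro card_mono) auto
      also have "\<dots> \<le> Suc (card (Suc ` c ` PW a (a + Suc t) N))" by (rule card_insert_le_m1) auto
      also have "\<dots> \<le> Suc r" using c by (simp add: card_image)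
      finally have dr: "card (d ` ?W M) \<le> Suc r" .
      obtain q where q: "q \<in> PW a (a + n) M"
        and qd: "\<And>g g'. length g = n \<Longrightarrow> length g' = n \<Longrightarrow> length (?tw g) = length (?tw g') \<Longrightarrow>
          length (?tw g) < n \<Longrightarrow> d (?tw (sub a q g)) = d (?tw (sub a q g'))"
        using M[OF dr] by blast
      \<comment> \<open>The colour belonging to the prefix length \<open>i\<close>, read off at a
        sample word.\<close>
      define e where "e i = d (?tw (sub a q (replicate i 0 @ replicate (n - i) a)))" for i
      have qe: "d (?tw (sub a q g)) = e (length (?tw g))" if "length g = n" "length (?tw g) < n" for g
      proof -
        have "?tw (replicate i 0 @ replicate (n - i) a) = replicate i 0" for i
          using a by (simp add: takeWhile_append takeWhile_replicate)
        then show ?thesis unfolding e_def using that by (intro qd) auto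
      qed
      have "e ` {..<n} \<subseteq> d ` ?W M"
      proof -
        have "?tw (sub a q g) \<in> ?W M" for g
          using q length_takeWhile_le[of _ "sub a q g"] set_takeWhileD[of _ _ "sub a q g"] by (auto simp: PW_def)
        then show ?thesis unfolding e_def by blast
      qed
      then have er: "card (e ` {..<n}) \<le> Suc r"
        by (intro order_trans[OF card_mono dr] finite_imageI finite_lists_length_le finite_lessThan)
      have "\<exists>j. m \<le> card {i\<in>{..<n}. e i = j}"
      proof (rule ccontr)
        assume neg: "\<not> ?thesis"
        then have m: "m > 0" by auto
        have fib: "card {i\<in>{..<n}. e i = j} \<le> m - 1" for j
          using neg by (metis Suc_pred' less_Suc_eq_le m not_le)
        have "n = card (\<Union>j\<in>e ` {..<n}. {i\<in>{..<n}. e i = j})"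
          by (subst (1) card_lessThan[symmetric], rule arg_cong[of _ _ card]) auto
        also have "\<dots> \<le> (\<Sum>j\<in>e ` {..<n}. card {i\<in>{..<n}. e i = j})" by (rule card_UN_le) simp
        also have "\<dots> \<le> card (e ` {..<n}) * (m - 1)"
          using sum_bounded_above[of "e ` {..<n}" "\<lambda>j. card {i\<in>{..<n}. e i = j}" "m - 1"] fib by simp
        also have "\<dots> \<le> Suc r * (m - 1)" using er by (rule mult_right_mono) simp
        also have "\<dots> < n" using m by (cases m) (auto simp: n_def)
        finally show False by simp
      qed
      then obtain j J where J: "J \<subseteq> {i\<in>{..<n}. e i = j}" "card J = m"
        by (meson obtain_subset_with_card_n)
      obtain p where p: "p \<in> PW a (a + m) n"
        and pJ: "\<And>g. length g = m \<Longrightarrow> length (?tw g) < m \<Longrightarrow> length (?tw (sub a p g)) \<in> J"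
        using PW_selecting_positions[OF a, of J n m] J by auto
      have qp: "sub a q p \<in> PW a (a + m) M" using q p by (intro sub_PW) auto
      have F: "sub a f (sub a q p) \<in> PW a (a + m) N" by (rule sub_PW[OF f]) (simp add: qp)
      \<comment> \<open>The subtraction undoes the \<open>Suc\<close> in \<open>d\<close>.\<close>
      have "c (sub a (sub a f (sub a q p)) g) = j - 1" if g: "g \<in> PW a (a + Suc t) m" for g
      proof -
        have pg: "sub a p g \<in> PW a (a + Suc t) n" using p g by (intro sub_PW) auto
        have qpg: "sub a q (sub a p g) \<in> PW a (a + Suc t) M" by (rule sub_PW[OF q]) (use pg in simp)
        \<comment> \<open>At least one parameter occurs in \<open>g\<close>, because
          \<open>Suc t\<close> is positive.\<close>
        have "length (?tw g) < m"
        proof -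
          have "\<not> set g \<subseteq> {..<a}"
          proof
            assume "set g \<subseteq> {..<a}"
            moreover have "pw a b w \<Longrightarrow> set w \<subseteq> {..<a} \<Longrightarrow> b = a" for b w
              by (induction w) auto
            ultimately show False using g by (fastforce simp: PW_def)
          qed
          then have "?tw g \<noteq> g" by (metis lessThan_iff set_takeWhileD subsetI)
          then have "length (?tw g) \<noteq> length g" by (metis takeWhile_eq_take take_all le_refl)
          then show ?thesis using g length_takeWhile_le[of _ g] by (auto simp: PW_def intro: le_neq_trans)
        qed
        then have *: "length (?tw (sub a p g)) \<in> J" using pJ g by (auto simp: PW_def)
        have "sub a (sub a f (sub a q p)) g = sub a f (sub a q (sub a p g))"
          using sub_assoc[OF f, of "sub a q p" g] sub_assoc[OF q, of p g] qp p q by (simp add: PW_def)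
        moreover have "Suc (c (sub a f (sub a q (sub a p g)))) = d (?tw (sub a q (sub a p g)))"
          using d[OF qpg] by simp
        moreover have "\<dots> = e (length (?tw (sub a p g)))"
          using * J pg by (intro qe) (auto simp: PW_def)
        moreover have "\<dots> = j" using * J by auto
        ultimately show ?thesis by simp
      qed
      then show ?thesis using F by blast
    qed
    then show ?thesis by blast
  qed
qed

text \<open>Even the case \<open>a = 0\<close> leads through larger alphabets, since parameters turn
  into constants on the way; hence \<open>a\<close> is arbitrary in the induction.\<close>

theorem graham_rothschild: "GR a t"
  by (induction t arbitrary: a) (auto intro: GR_0 GR_Suc)

section \<open>Faces as parameters\<close>

text \<open>The empty face is required explicitly: a face may have an empty trace on a copy, and
  this trace must have an index too.\<close>

definition face_family :: "nat set set \<Rightarrow> bool" where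
  "face_family S \<longleftrightarrow> finite S \<and> {} \<in> S \<and> (\<forall>u v. u \<subseteq> v \<and> v \<in> S \<longrightarrow> u \<in> S) \<and> (\<forall>u\<in>S. finite u)"

definition face :: "nat set set \<Rightarrow> nat \<Rightarrow> nat set" where
  "face S i = set_decode (sorted_list_of_set (set_encode ` S) ! i)"

section \<open>Comparison of sets by their binary codes\<close>

lemma set_encode_less:
  assumes "finite A" "finite B" "m \<in> B" "m \<notin> A" "\<And>x. x > m \<Longrightarrow> x \<in> A \<longleftrightarrow> x \<in> B"
  shows "set_encode A < set_encode B"
proof -
  have sum: "set_encode X = sum ((^) 2) (X \<inter> {..<m}) + sum ((^) 2) (X \<inter> {m..})" if "finite X" for X
    unfolding set_encode_def using that
    by (subst sum.union_disjoint[symmetric]) (auto intro!: sum.cong)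
  \<comment> \<open>The bits below \<open>m\<close> add up to less than \<open>2 ^ m\<close>, so the
    bit \<open>m\<close> outweighs them.\<close>
  have "sum ((^) 2) (A \<inter> {..<m}) \<le> sum ((^) (2::nat)) {..<m}" by (rule sum_mono2) auto
  also have "\<dots> < 2 ^ m" by (simp add: lessThan_atLeast0 sum_power2)
  finally have low: "sum ((^) 2) (A \<inter> {..<m}) < (2::nat) ^ m" .
  have "B \<inter> {m..} = insert m (A \<inter> {m..})"
    using assms(3,5) by (auto simp: le_less)
  then have "sum ((^) 2) (B \<inter> {m..}) = (2::nat) ^ m + sum ((^) 2) (A \<inter> {m..})"
    using assms(1,4) by simp
  then show ?thesis using sum[OF assms(1)] sum[OF assms(2)] low by simp
qed

lemma set_encode_lessD:
  assumes "finite A" "finite B" "set_encode A < set_encode B"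
  obtains m where "m \<in> B" "m \<notin> A" "\<And>x. x > m \<Longrightarrow> x \<in> A \<longleftrightarrow> x \<in> B"
proof -
  define D where "D = (A - B) \<union> (B - A)"
  have D: "finite D" "D \<noteq> {}" using assms by (auto simp: D_def)
  have above: "x \<in> A \<longleftrightarrow> x \<in> B" if "x > Max D" for x
    using that Max_ge[OF D(1), of x] by (auto simp: D_def)
  \<comment> \<open>If the largest difference belonged to \<open>A\<close>, the codes would compare
    the other way.\<close>
  have "\<not> (Max D \<in> A \<and> Max D \<notin> B)"
    using set_encode_less[OF assms(2,1)] above assms(3) by (metis less_asym)
  then show ?thesis using Max_in[OF D] above that by (auto simp: D_def)
qed

lemma set_encode_mono: "finite B \<Longrightarrow> A \<subseteq> B \<Longrightarrow> set_encode A \<le> set_encode B"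
  unfolding set_encode_def by (rule sum_mono2) auto

lemma
  assumes "face_family S"
  shows face_in: "i < card S \<Longrightarrow> face S i \<in> S"
    and face_surj: "u \<in> S \<Longrightarrow> \<exists>i<card S. face S i = u"
    and face_less: "i < card S \<Longrightarrow> j < card S \<Longrightarrow>
      set_encode (face S i) < set_encode (face S j) \<longleftrightarrow> i < j"
proof -
  let ?l = "sorted_list_of_set (set_encode ` S)"
  have fin: "finite S" "\<And>u. u \<in> S \<Longrightarrow> finite u" using assms by (auto simp: face_family_def)
  have "inj_on set_encode S" using inj_on_set_encode fin(2) by (auto intro: inj_on_subset)
  then have len: "length ?l = card S" by (simp add: card_image)
  have set: "set ?l = set_encode ` S" using fin by simp
  show "i < card S \<Longrightarrow> face S i \<in> S"
    using nth_mem[of i ?l] len set fin(2) by (auto simp: face_def)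
  show "u \<in> S \<Longrightarrow> \<exists>i<card S. face S i = u"
    using len set fin(2) by (metis face_def imageI in_set_conv_nth set_encode_inverse)
  have less: "?l ! i < ?l ! j" if "i < j" "j < card S" for i j
    using that len strict_sorted_list_of_set[of "set_encode ` S"] by (metis sorted_wrt_nth_less)
  show "set_encode (face S i) < set_encode (face S j) \<longleftrightarrow> i < j" if "i < card S" "j < card S"
    using less[of i j] less[of j i] that by (cases i j rule: linorder_cases) (auto simp: face_def)
qed

lemma PW_nth_less: "w \<in> PW a b N \<Longrightarrow> n < length w \<Longrightarrow> w ! n < b"
  using pw_less[of a b w "w ! n"] by (simp add: PW_def)

section \<open>Parameter words described by first occurrences\<close>

lemma pw_first_occurrence:
  assumes "pw a b w" "n < length w" "y < w ! n" "a \<le> y"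
  shows "\<exists>j<n. w ! j = y"
  using assms
proof (induction w arbitrary: a n)
  case (Cons z w)
  show ?case
  proof (cases n)
    case 0
    then show ?thesis using Cons.prems by auto
  next
    case (Suc i)
    show ?thesis
    proof (cases "z = a \<and> y = a")
      case True
      then show ?thesis using Suc by (intro exI[of _ 0]) simp
    next
      case False
      then have "\<exists>j<i. w ! j = y"
        using Cons.prems Cons.IH[of a i] Cons.IH[of "Suc a" i] Suc by auto
      then obtain j where "j < i" "w ! j = y" by blast
      then show ?thesis using Suc by (intro exI[of _ "Suc j"]) simp
    qed
  qed
qed simp

text \<open>The converse of \<open>pw_first_occurrence\<close> and \<open>set_pw\<close>. It
  recognises words that are given by a function of the position instead of letter by letter.\<close>

lemma pwI:
  assumes "set w \<union> {..<a} = {..<b}"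
    and "\<And>n y. n < length w \<Longrightarrow> y < w ! n \<Longrightarrow> a \<le> y \<Longrightarrow> \<exists>j<n. w ! j = y"
  shows "pw a b w"
  using assms
proof (induction w arbitrary: a)
  case Nil
  then show ?case by simp
next
  case (Cons z w)
  \<comment> \<open>A first letter above \<open>a\<close> would require an occurrence of
    \<open>a\<close> before position \<open>0\<close>.\<close>
  have za: "z \<le> a" using Cons.prems(2)[of 0 a] by force
  show ?case
  proof (cases "z = a")
    case True
    have "\<exists>j<n. w ! j = y" if "n < length w" "y < w ! n" "Suc a \<le> y" for n y
      using Cons.prems(2)[of "Suc n" y] that True by (auto simp: less_Suc_eq_0_disj)
    moreover have "set w \<union> {..<Suc a} = {..<b}" unfolding Cons.prems(1)[symmetric] using True by auto
    ultimately show ?thesis using Cons.IH[of "Suc a"] True by simp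
  next
    case False
    then have "z < a" using za by simp
    have "\<exists>j<n. w ! j = y" if "n < length w" "y < w ! n" "a \<le> y" for n y
      using Cons.prems(2)[of "Suc n" y] that \<open>z < a\<close> by (auto simp: less_Suc_eq_0_disj)
    moreover have "set w \<union> {..<a} = {..<b}" unfolding Cons.prems(1)[symmetric] using \<open>z < a\<close> by auto
    ultimately show ?thesis using Cons.IH[of a] \<open>z < a\<close> by simp
  qed
qed

lemma set_pw: "pw a b w \<Longrightarrow> set w \<union> {..<a} = {..<b}"
proof (induction w arbitrary: a)
  case (Cons z w)
  then show ?case
    by (auto simp: lessThan_Suc dest!: Cons.IH)
qed simp

text \<open>The set \<open>{n. a \<in> face S (w ! n)}\<close> is reversed before it is coded so that its minimum becomes the
  most significant bit.\<close>

definition vertex_code :: "nat set set \<Rightarrow> nat list \<Rightarrow> nat \<Rightarrow> nat" where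
  "vertex_code S w a = set_encode ((\<lambda>n. length w - 1 - n) ` {n. n < length w \<and> a \<in> face S (w ! n)})"

lemma set_decode_vertex_code:
  "set_decode (vertex_code S w a) = {i. i < length w \<and> a \<in> face S (w ! (length w - 1 - i))}"
proof -
  have "finite ((\<lambda>n. length w - 1 - n) ` {n. n < length w \<and> a \<in> face S (w ! n)})" by simp
  then have "set_decode (vertex_code S w a) = (\<lambda>n. length w - 1 - n) ` {n. n < length w \<and> a \<in> face S (w ! n)}"
    unfolding vertex_code_def by (rule set_encode_inverse)
  also have "\<dots> = {i. i < length w \<and> a \<in> face S (w ! (length w - 1 - i))}"
  proof (intro set_eqI iffI)
    fix i assume "i \<in> {i. i < length w \<and> a \<in> face S (w ! (length w - 1 - i))}"
    then show "i \<in> (\<lambda>n. length w - 1 - n) ` {n. n < length w \<and> a \<in> face S (w ! n)}"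
      by (intro image_eqI[of _ _ "length w - 1 - i"]) auto
  qed (auto simp: Suc_diff_Suc)
  finally show ?thesis .
qed

text \<open>A common bit stands for a position whose face contains all of \<open>u\<close>, and
  faces are closed under subsets. Conversely \<open>w\<close> is onto, so the face \<open>u\<close>
  itself is read somewhere.\<close>

lemma vertex_code_face:
  assumes S: "face_family S" and w: "w \<in> PW 0 (card S) N" and u: "u \<subseteq> \<Union>S"
  shows "(\<exists>n. \<forall>x\<in>vertex_code S w ` u. n \<in> set_decode x) \<longleftrightarrow> u \<in> S"
proof
  assume "\<exists>n. \<forall>x\<in>vertex_code S w ` u. n \<in> set_decode x"
  then obtain n where n: "\<And>a. a \<in> u \<Longrightarrow> n < length w \<and> a \<in> face S (w ! (length w - 1 - n))"
    by (auto simp: set_decode_vertex_code)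
  show "u \<in> S"
  proof (cases "u = {}")
    case True
    then show ?thesis using S by (simp add: face_family_def)
  next
    case False
    then have "n < length w" "u \<subseteq> face S (w ! (length w - 1 - n))" using n by auto
    moreover from this have "w ! (length w - 1 - n) < card S"
      by (intro PW_nth_less[OF w]) auto
    ultimately show ?thesis using S face_in[OF S] unfolding face_family_def by blast
  qed
next
  assume "u \<in> S"
  then obtain i where i: "i < card S" "face S i = u" using face_surj[OF S] by blast
  then have "i \<in> set w" using w set_pw[of 0 "card S" w] by (auto simp: PW_def)
  then obtain n where n: "n < length w" "w ! n = i" by (auto simp: in_set_conv_nth)
  then have "length w - 1 - n < length w" "length w - 1 - (length w - 1 - n) = n" by auto
  then show "\<exists>n. \<forall>x\<in>vertex_code S w ` u. n \<in> set_decode x"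
    using n i by (intro exI[of _ "length w - 1 - n"]) (auto simp: set_decode_vertex_code)
qed

lemma vertex_code_range:
  assumes S: "face_family S" and w: "w \<in> PW 0 (card S) N" and a: "a \<in> \<Union>S"
  shows "vertex_code S w a \<in> {1..<2 ^ N}"
proof -
  have "{a} \<in> S" using S a unfolding face_family_def by blast
  then obtain n where n: "n \<in> set_decode (vertex_code S w a)"
    using vertex_code_face[OF S w, of "{a}"] a by auto
  have "vertex_code S w a \<noteq> 0"
  proof
    assume "vertex_code S w a = 0"
    with n show False by simp
  qed
  moreover have "vertex_code S w a < set_encode {N}"
  proof -
    have "vertex_code S w a = set_encode (set_decode (vertex_code S w a))" by simp
    also have "\<dots> < set_encode {N}"
      using w by (intro set_encode_less[of _ _ N]) (auto simp: set_decode_vertex_code PW_def)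
    finally show ?thesis .
  qed
  ultimately show ?thesis by simp
qed

text \<open>Since \<open>{b}\<close> precedes, in the order of codes, every face containing \<open>b\<close>, and \<open>{a}\<close> precedes
  \<open>{b}\<close>, the vertex \<open>a\<close> shows up in the word before \<open>b\<close> does.\<close>

lemma vertex_code_less:
  assumes S: "face_family S" and w: "w \<in> PW 0 (card S) N"
    and ab: "a \<in> \<Union>S" "b \<in> \<Union>S" "a < b"
  shows "vertex_code S w b < vertex_code S w a"
proof -
  have sing: "{a} \<in> S" "{b} \<in> S" using S ab unfolding face_family_def by blast+
  obtain n where n: "n \<in> set_decode (vertex_code S w a)"
    using vertex_code_face[OF S w, of "{a}"] ab sing by auto
  define P where "P n \<longleftrightarrow> n < length w \<and> a \<in> face S (w ! n)" for n
  define n0 where "n0 = (LEAST n. P n)"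
  have "P (length w - 1 - n)" using n by (auto simp: P_def set_decode_vertex_code)
  then have "P n0" unfolding n0_def by (rule LeastI)
  then have n0: "n0 < length w" "a \<in> face S (w ! n0)" by (auto simp: P_def)
  have before: "a \<notin> face S (w ! n)" if "n < n0" for n
    using that not_less_Least[of n P] n0 by (auto simp: n0_def P_def)
  have b: "b \<notin> face S (w ! n)" if "n \<le> n0" for n
  proof
    assume bn: "b \<in> face S (w ! n)"
    have nw: "n < length w" using that n0 by simp
    then have wn: "w ! n < card S" by (rule PW_nth_less[OF w])
    obtain y where y: "y < card S" "face S y = {a}" using face_surj[OF S sing(1)] by blast
    have "set_encode {a} < set_encode {b}"
      using ab by (intro set_encode_less[of _ _ b]) auto
    also have "\<dots> \<le> set_encode (face S (w ! n))"
      using bn face_in[OF S wn] S by (intro set_encode_mono) (auto simp: face_family_def)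
    finally have "y < w ! n" using face_less[OF S y(1) wn] y by simp
    then obtain j where "j < n" "w ! j = y"
      using pw_first_occurrence[of 0 "card S" w n y] w nw by (auto simp: PW_def)
    then show False using before[of j] that y by simp
  qed
  let ?A = "set_decode (vertex_code S w a)" and ?B = "set_decode (vertex_code S w b)"
  have "set_encode ?B < set_encode ?A"
  proof (rule set_encode_less[of _ _ "length w - 1 - n0"])
    have "length w - 1 - (length w - 1 - n0) = n0" using n0 by simp
    then show "length w - 1 - n0 \<in> ?A" "length w - 1 - n0 \<notin> ?B"
      using n0 b[of n0] by (auto simp: set_decode_vertex_code)
    \<comment> \<open>Higher bits stand for positions before \<open>n0\<close>, where neither
      \<open>a\<close> nor \<open>b\<close> occurs.\<close>
    fix x assume x: "length w - 1 - n0 < x"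
    then have "length w - 1 - x < n0" if "x < length w" using that n0 by linarith
    then show "x \<in> ?B \<longleftrightarrow> x \<in> ?A"
      using before b by (auto simp: set_decode_vertex_code)
  qed auto
  then show ?thesis by simp
qed

text \<open>The word \<open>g\<close> traces the faces of \<open>SB\<close> on the copy of \<open>SA\<close>. Every trace is itself a face,
  so its first occurrence is at its own position; hence traces first occur in the order of codes.\<close>

lemma face_trace_word:
  assumes A: "face_family SA" and B: "face_family SB"
    and mono: "strict_mono_on (\<Union>SA) \<phi>"
    and faces: "\<And>u. u \<subseteq> \<Union>SA \<Longrightarrow> u \<in> SA \<longleftrightarrow> \<phi> ` u \<in> SB"
  obtains g where "g \<in> PW 0 (card SA) (card SB)"
    "\<And>i. i < card SB \<Longrightarrow> face SA (g ! i) = {a \<in> \<Union>SA. \<phi> a \<in> face SB i}"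
proof -
  have inj: "inj_on \<phi> (\<Union>SA)" using mono by (rule strict_mono_on_imp_inj_on)
  have "\<exists>x<card SA. face SA x = {a \<in> \<Union>SA. \<phi> a \<in> face SB i}" if "i < card SB" for i
  proof -
    have "\<phi> ` {a \<in> \<Union>SA. \<phi> a \<in> face SB i} \<subseteq> face SB i" by auto
    then have "\<phi> ` {a \<in> \<Union>SA. \<phi> a \<in> face SB i} \<in> SB"
      using B face_in[OF B that] unfolding face_family_def by blast
    then have "{a \<in> \<Union>SA. \<phi> a \<in> face SB i} \<in> SA" by (subst faces) auto
    then show ?thesis using face_surj[OF A] by blast
  qed
  then obtain G where G: "\<And>i. i < card SB \<Longrightarrow> G i < card SA"
    "\<And>i. i < card SB \<Longrightarrow> face SA (G i) = {a \<in> \<Union>SA. \<phi> a \<in> face SB i}" by metis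
  have inj_face: "x = y" if "face SA x = face SA y" "x < card SA" "y < card SA" for x y
    using face_less[OF A that(2,3)] face_less[OF A that(3,2)] that(1) by auto
  have preim: "\<exists>j<card SB. face SB j = \<phi> ` face SA y \<and> G j = y" if y: "y < card SA" for y
  proof -
    have sub: "face SA y \<subseteq> \<Union>SA" using face_in[OF A y] by blast
    then have "\<phi> ` face SA y \<in> SB" using faces face_in[OF A y] by blast
    then obtain j where j: "j < card SB" "face SB j = \<phi> ` face SA y" using face_surj[OF B] by blast
    have "face SA (G j) = face SA y"
      unfolding G(2)[OF j(1)] j(2) using sub inj_on_image_mem_iff[OF inj _ sub] by blast
    then show ?thesis using j inj_face G(1) y by blast
  qed
  have "pw 0 (card SA) (map G [0..<card SB])"
  proof (rule pwI)
    show "set (map G [0..<card SB]) \<union> {..<0} = {..<card SA}"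
      using G(1) preim by (auto simp: image_iff) (metis atLeastLessThan_iff le0)
  next
    fix n y assume "n < length (map G [0..<card SB])" and y: "y < map G [0..<card SB] ! n"
    then have n: "n < card SB" and yn: "y < G n" by auto
    have yA: "y < card SA" using yn G(1)[OF n] by simp
    obtain j where j: "j < card SB" "face SB j = \<phi> ` face SA y" "G j = y" using preim[OF yA] by blast
    have sub: "face SA y \<subseteq> \<Union>SA" "face SA (G n) \<subseteq> \<Union>SA"
      using face_in[OF A yA] face_in[OF A G(1)[OF n]] by blast+
    have fin: "finite (face SA y)" "finite (face SA (G n))" "finite (face SB n)"
      using A B face_in[OF A yA] face_in[OF A G(1)[OF n]] face_in[OF B n] by (auto simp: face_family_def)
    have "set_encode (face SA y) < set_encode (face SA (G n))"
      using face_less[OF A yA G(1)[OF n]] yn by simp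
    then obtain m where m: "m \<in> face SA (G n)" "m \<notin> face SA y"
      "\<And>x. x > m \<Longrightarrow> x \<in> face SA y \<longleftrightarrow> x \<in> face SA (G n)"
      using set_encode_lessD[OF fin(1,2)] by metis
    \<comment> \<open>Since \<phi> is increasing, it carries the largest difference \<open>m\<close>
      to the largest difference of the images.\<close>
    have "set_encode (\<phi> ` face SA y) < set_encode (\<phi> ` face SA (G n))"
    proof (rule set_encode_less[of _ _ "\<phi> m"])
      show "\<phi> m \<notin> \<phi> ` face SA y" using m(1,2) sub(2) inj_on_image_mem_iff[OF inj _ sub(1), of m] by blast
      fix z assume z: "\<phi> m < z"
      have "x > m" if "x \<in> \<Union>SA" "z = \<phi> x" for x
        using z that m(1) sub mono by (metis linorder_neqE_nat not_less_iff_gr_or_eq strict_mono_on_def subsetD)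
      then show "z \<in> \<phi> ` face SA y \<longleftrightarrow> z \<in> \<phi> ` face SA (G n)"
        using m(3) sub by blast
    qed (use m fin in auto)
    also have "\<phi> ` face SA (G n) \<subseteq> face SB n" using G(2)[OF n] by auto
    then have "set_encode (\<phi> ` face SA (G n)) \<le> set_encode (face SB n)"
      by (rule set_encode_mono[OF fin(3)])
    finally have "set_encode (face SB j) < set_encode (face SB n)" using j by simp
    then have "j < n" using face_less[OF B j(1) n] by simp
    then show "\<exists>j<n. map G [0..<card SB] ! j = y"
      using j by (intro exI[of _ j]) auto
  qed
  then show ?thesis using that[of "map G [0..<card SB]"] G(2) by (simp add: PW_def)
qed

text \<open>A word for the faces of \<open>SA\<close> gets the colour of the vertex set that it
  codes. If \<open>h\<close> codes a copy of \<open>SB\<close> and \<open>g\<close> is the trace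
  word of an embedding \<phi>, then \<open>sub 0 h g\<close> codes the copy of \<open>SA\<close>
  given by \<phi> inside it; so monochromatic compositions mean monochromatic copies.\<close>

lemma face_family_ramsey:
  assumes A: "face_family SA" and B: "face_family SB"
  shows "\<exists>N. \<forall>c :: nat set \<Rightarrow> nat. (\<forall>Y. c Y < r) \<longrightarrow>
    (\<exists>h\<in>PW 0 (card SB) N. \<exists>j. \<forall>\<phi>. strict_mono_on (\<Union>SA) \<phi> \<longrightarrow>
       (\<forall>u\<subseteq>\<Union>SA. u \<in> SA \<longleftrightarrow> \<phi> ` u \<in> SB) \<longrightarrow> c (vertex_code SB h ` \<phi> ` \<Union>SA) = j)"
proof -
  obtain N where N: "\<And>c :: nat list \<Rightarrow> nat. card (c ` PW 0 (card SA) N) \<le> r \<Longrightarrow>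
     \<exists>f\<in>PW 0 (card SB) N. \<exists>j. \<forall>g\<in>PW 0 (card SA) (card SB). c (sub 0 f g) = j"
    using graham_rothschild[of 0 "card SA"] unfolding GR_def add_0 by metis
  have "\<exists>h\<in>PW 0 (card SB) N. \<exists>j. \<forall>\<phi>. strict_mono_on (\<Union>SA) \<phi> \<longrightarrow>
       (\<forall>u\<subseteq>\<Union>SA. u \<in> SA \<longleftrightarrow> \<phi> ` u \<in> SB) \<longrightarrow> c (vertex_code SB h ` \<phi> ` \<Union>SA) = j"
    if c: "\<forall>Y. c Y < r" for c :: "nat set \<Rightarrow> nat"
  proof -
    have "(\<lambda>w. c (vertex_code SA w ` \<Union>SA)) ` PW 0 (card SA) N \<subseteq> {..<r}" using c by auto
    then have "card ((\<lambda>w. c (vertex_code SA w ` \<Union>SA)) ` PW 0 (card SA) N) \<le> r"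
      by (metis card_lessThan card_mono finite_lessThan)
    from N[OF this] obtain h j where h: "h \<in> PW 0 (card SB) N"
      and hj: "\<And>g. g \<in> PW 0 (card SA) (card SB) \<Longrightarrow> c (vertex_code SA (sub 0 h g) ` \<Union>SA) = j" by blast
    have "c (vertex_code SB h ` \<phi> ` \<Union>SA) = j"
      if phi: "strict_mono_on (\<Union>SA) \<phi>" "\<forall>u\<subseteq>\<Union>SA. u \<in> SA \<longleftrightarrow> \<phi> ` u \<in> SB" for \<phi>
    proof -
      obtain g where g: "g \<in> PW 0 (card SA) (card SB)"
        "\<And>i. i < card SB \<Longrightarrow> face SA (g ! i) = {a \<in> \<Union>SA. \<phi> a \<in> face SB i}"
        by (rule face_trace_word[OF A B phi(1)]) (use phi(2) in blast)+
      \<comment> \<open>At each position the composed word reads the trace of the face read by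
        \<open>h\<close>, and \<open>a\<close> is in the trace iff \<open>\<phi> a\<close> is in the
        face.\<close>
      have "vertex_code SA (sub 0 h g) a = vertex_code SB h (\<phi> a)" if a: "a \<in> \<Union>SA" for a
      proof -
        have "a \<in> face SA (sub 0 h g ! n) \<longleftrightarrow> \<phi> a \<in> face SB (h ! n)" if "n < length h" for n
        proof -
          have "h ! n < card SB" by (rule PW_nth_less[OF h that])
          then show ?thesis using g(2) a that by (auto simp: sub_def)
        qed
        then have "{n. n < length h \<and> a \<in> face SA (sub 0 h g ! n)} = {n. n < length h \<and> \<phi> a \<in> face SB (h ! n)}"
          by blast
        then show ?thesis by (simp add: vertex_code_def)
      qed
      then have "vertex_code SA (sub 0 h g) ` \<Union>SA = vertex_code SB h ` \<phi> ` \<Union>SA"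
        unfolding image_image by (rule image_cong[OF refl])
      then show ?thesis using hj[OF g(1)] by simp
    qed
    then show ?thesis by (intro bexI[OF _ h] exI[of _ j] allI impI)
  qed
  then show ?thesis by (intro exI[of _ N] allI impI)
qed

section \<open>The Ramsey property\<close>

definition induced :: "'a struct \<Rightarrow> 'a set \<Rightarrow> 'a struct" where
  "induced N U = \<lparr>univ = U, Rel = (\<lambda>i. {xs \<in> Rel N i. set xs \<subseteq> U}), Less = Less N \<inter> (U \<times> U)\<rparr>"

lemma univ_induced [simp]: "univ (induced N U) = U"
  by (simp add: induced_def)

lemma induced_substruct: "is_struct N \<Longrightarrow> U \<subseteq> univ N \<Longrightarrow> induced N U \<unlhd> N"
  by (fastforce simp: induced_def substruct_def is_struct_def)

text \<open>By this, colouring copies amounts to colouring vertex sets. The index \<open>0\<close>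
  is covered by the convention in \<open>is_struct\<close>.\<close>

lemma substruct_induced: "M \<unlhd> N \<Longrightarrow> M = induced N (univ M)"
proof -
  assume *: "M \<unlhd> N"
  then have "Rel M i = {xs \<in> Rel N i. set xs \<subseteq> univ M}" for i
    by (cases "i = 0") (auto simp: substruct_def is_struct_def)
  then show ?thesis using * by (intro struct.equality) (auto simp: induced_def substruct_def)
qed

lemma substruct_trans: "K \<unlhd> M \<Longrightarrow> M \<unlhd> N \<Longrightarrow> K \<unlhd> N"
  by (fastforce simp: substruct_def)

lemma isomorphic_sym: "M \<simeq> N \<Longrightarrow> N \<simeq> M"
proof -
  assume "M \<simeq> N"
  then obtain f where f: "struct_iso f M N" by (auto simp: isomorphic_def)
  let ?g = "inv_into (univ M) f"
  have bij: "bij_betw f (univ M) (univ N)" using f by (simp add: struct_iso_def)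
  then have g: "bij_betw ?g (univ N) (univ M)" by (rule bij_betw_inv_into)
  have fg: "f (?g y) = y" if "y \<in> univ N" for y using bij that by (rule bij_betw_inv_into_right)
  have gM: "?g y \<in> univ M" if "y \<in> univ N" for y using g that by (rule bij_betwE[rule_format])
  have "xs \<in> Rel N i \<longleftrightarrow> map ?g xs \<in> Rel M i" if "i \<ge> 1" "length xs = i" "set xs \<subseteq> univ N" for i xs
  proof -
    have "map f (map ?g xs) = xs" using fg that(3) by (auto simp: map_idI subset_iff)
    moreover have "set (map ?g xs) \<subseteq> univ M" using gM that(3) by auto
    ultimately show ?thesis using f that by (metis length_map struct_iso_def)
  qed
  moreover have "(x, y) \<in> Less N \<longleftrightarrow> (?g x, ?g y) \<in> Less M" if "x \<in> univ N" "y \<in> univ N" for x y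
  proof -
    have "(?g x, ?g y) \<in> Less M \<longleftrightarrow> (f (?g x), f (?g y)) \<in> Less N"
      using f gM that by (simp add: struct_iso_def)
    then show ?thesis using fg that by simp
  qed
  ultimately have "struct_iso ?g N M" using f g by (simp add: struct_iso_def)
  then show ?thesis by (auto simp: isomorphic_def)
qed

lemma struct_iso_comp:
  assumes f: "struct_iso f K M" and g: "struct_iso g M N"
  shows "struct_iso (g \<circ> f) K N"
proof -
  have bij: "bij_betw f (univ K) (univ M)" using f by (simp add: struct_iso_def)
  have fM: "f x \<in> univ M" if "x \<in> univ K" for x using bij that by (rule bij_betwE[rule_format])
  have "xs \<in> Rel K i \<longleftrightarrow> map (g \<circ> f) xs \<in> Rel N i" if "i \<ge> 1" "length xs = i" "set xs \<subseteq> univ K" for i xs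
  proof -
    have "set (map f xs) \<subseteq> univ M" using fM that(3) by auto
    then have "map f xs \<in> Rel M i \<longleftrightarrow> map g (map f xs) \<in> Rel N i"
      using g that unfolding struct_iso_def by (metis length_map)
    then show ?thesis using f that unfolding struct_iso_def by (metis map_map)
  qed
  moreover have "(x, y) \<in> Less K \<longleftrightarrow> ((g \<circ> f) x, (g \<circ> f) y) \<in> Less N" if "x \<in> univ K" "y \<in> univ K" for x y
    using f g fM that by (simp add: struct_iso_def)
  moreover have "bij_betw (g \<circ> f) (univ K) (univ N)"
    using bij g bij_betw_trans by (auto simp: struct_iso_def)
  moreover have "is_struct K" "is_struct N" using f g by (simp_all add: struct_iso_def)
  ultimately show ?thesis unfolding struct_iso_def by blast
qed

lemma isomorphic_trans: "K \<simeq> M \<Longrightarrow> M \<simeq> N \<Longrightarrow> K \<simeq> N"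
  using struct_iso_comp by (metis isomorphic_def)

section \<open>Polyhedra as structures\<close>

lemma poly_struct_simps [simp]:
  "univ (poly_struct A S L) = A"
  "Less (poly_struct A S L) = L"
  "xs \<in> Rel (poly_struct A S L) i \<longleftrightarrow> i \<ge> 1 \<and> length xs = i \<and> distinct xs \<and> set xs \<in> S"
  by (auto simp: poly_struct_def)

lemma is_struct_poly_struct: "ordered_polyhedron A S L \<Longrightarrow> is_struct (poly_struct A S L)"
  by (auto simp: is_struct_def ordered_polyhedron_def polyhedron_def)

lemma ordered_polyhedron_restrict:
  assumes "ordered_polyhedron A S L" "U \<subseteq> A"
  shows "ordered_polyhedron U {u \<in> S. u \<subseteq> U} (L \<inter> U \<times> U)"
proof -
  have "{x} \<in> S" if "x \<in> U" for x
    using assms that unfolding ordered_polyhedron_def polyhedron_def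
    by (metis UnionE bot.extremum insert_subset subsetD)
  then have "\<Union>{u \<in> S. u \<subseteq> U} = U" by blast
  moreover have "strict_linear_order_on U (L \<inter> U \<times> U)"
    using assms unfolding ordered_polyhedron_def strict_linear_order_on_def trans_def irrefl_def total_on_def
    by blast
  moreover have "countable U"
    using assms countable_subset by (auto simp: ordered_polyhedron_def polyhedron_def)
  ultimately show ?thesis
    using assms(1) unfolding ordered_polyhedron_def polyhedron_def by (auto; blast)
qed

lemma induced_poly_struct: "induced (poly_struct A S L) U = poly_struct U {u \<in> S. u \<subseteq> U} (L \<inter> U \<times> U)"
  by (auto simp: induced_def poly_struct_def)

text \<open>Relations of positive arity do not see the empty face, hence the condition
  \<open>u \<noteq> {}\<close>. Any other finite set is tested through an enumeration without
  repetitions.\<close>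

lemma struct_iso_poly_struct:
  assumes "ordered_polyhedron A S L" "ordered_polyhedron A' S' L'"
  shows "struct_iso f (poly_struct A S L) (poly_struct A' S' L') \<longleftrightarrow>
    bij_betw f A A' \<and> (\<forall>u\<subseteq>A. finite u \<longrightarrow> u \<noteq> {} \<longrightarrow> (u \<in> S \<longleftrightarrow> f ` u \<in> S')) \<and>
    (\<forall>x\<in>A. \<forall>y\<in>A. (x, y) \<in> L \<longleftrightarrow> (f x, f y) \<in> L')"
proof (intro iffI conjI)
  assume f: "struct_iso f (poly_struct A S L) (poly_struct A' S' L')"
  then show "bij_betw f A A'" "\<forall>x\<in>A. \<forall>y\<in>A. (x, y) \<in> L \<longleftrightarrow> (f x, f y) \<in> L'"
    by (simp_all add: struct_iso_def)
  then have inj: "inj_on f A" by (simp add: bij_betw_def)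
  show "\<forall>u\<subseteq>A. finite u \<longrightarrow> u \<noteq> {} \<longrightarrow> (u \<in> S \<longleftrightarrow> f ` u \<in> S')"
  proof (intro allI impI)
    fix u assume u: "u \<subseteq> A" "finite u" "u \<noteq> {}"
    obtain xs where xs: "set xs = u" "distinct xs" using finite_distinct_list[OF u(2)] by blast
    have len: "length xs \<ge> 1" using xs u by (cases xs) auto
    have "ys \<in> Rel (poly_struct A S L) i \<longleftrightarrow> map f ys \<in> Rel (poly_struct A' S' L') i"
      if "1 \<le> i" "length ys = i" "set ys \<subseteq> A" for i ys
      using f that unfolding struct_iso_def poly_struct_simps(1) by blast
    from this[OF len refl] u xs
    have "xs \<in> Rel (poly_struct A S L) (length xs) \<longleftrightarrow> map f xs \<in> Rel (poly_struct A' S' L') (length xs)"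
      by blast
    moreover have "distinct (map f xs)" using xs u inj by (auto simp: distinct_map intro: inj_on_subset)
    ultimately show "u \<in> S \<longleftrightarrow> f ` u \<in> S'" using len xs by auto
  qed
next
  assume *: "bij_betw f A A' \<and> (\<forall>u\<subseteq>A. finite u \<longrightarrow> u \<noteq> {} \<longrightarrow> (u \<in> S \<longleftrightarrow> f ` u \<in> S')) \<and>
    (\<forall>x\<in>A. \<forall>y\<in>A. (x, y) \<in> L \<longleftrightarrow> (f x, f y) \<in> L')"
  have "xs \<in> Rel (poly_struct A S L) i \<longleftrightarrow> map f xs \<in> Rel (poly_struct A' S' L') i"
    if "i \<ge> 1" "length xs = i" "set xs \<subseteq> A" for i xs
  proof -
    have "inj_on f (set xs)" using * that(3) by (auto simp: bij_betw_def intro: inj_on_subset)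
    moreover have "set xs \<noteq> {}" using that by auto
    ultimately show ?thesis using * that by (auto simp: distinct_map)
  qed
  then show "struct_iso f (poly_struct A S L) (poly_struct A' S' L')"
    using * is_struct_poly_struct[OF assms(1)] is_struct_poly_struct[OF assms(2)]
    by (simp add: struct_iso_def)
qed

section \<open>Transfer to the natural numbers\<close>

definition nat_poly :: "nat set set \<Rightarrow> nat struct" where
  "nat_poly S = poly_struct (\<Union>S) S {(x, y). x \<in> \<Union>S \<and> y \<in> \<Union>S \<and> x < y}"

lemma ordered_polyhedron_nat:
  assumes "face_family S"
  shows "ordered_polyhedron (\<Union>S) S {(x, y). x \<in> \<Union>S \<and> y \<in> \<Union>S \<and> x < y}"
  using assms unfolding ordered_polyhedron_def polyhedron_def face_family_def
    strict_linear_order_on_def trans_def irrefl_def total_on_def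
  by (auto; blast)

text \<open>Counting predecessors carries the given order to the natural one, and faces acquire
  binary codes.\<close>

lemma KP_isomorphic_nat_poly:
  assumes "X \<in> KP k"
  obtains S where "face_family S" "\<And>u. u \<in> S \<Longrightarrow> card u \<le> k" "X \<simeq> nat_poly S"
proof -
  obtain A S L where X: "X = poly_struct A S L" and P: "ordered_polyhedron A S L"
    and A: "finite A" and k: "\<And>u. u \<in> S \<Longrightarrow> card u \<le> k"
    using assms by (auto simp: KP_def)
  have S: "\<Union>S = A" "\<And>u v. u \<subseteq> v \<Longrightarrow> v \<in> S \<Longrightarrow> u \<in> S" and L: "L \<subseteq> A \<times> A" "trans L" "irrefl L" "total_on A L"
    using P unfolding ordered_polyhedron_def polyhedron_def strict_linear_order_on_def by blast+
  have SA: "u \<subseteq> A" if "u \<in> S" for u using S(1) that by blast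
  have finS: "finite S" using SA A by (meson PowI finite_Pow_iff finite_subset subsetI)
  define \<rho> where "\<rho> x = card {z \<in> A. (z, x) \<in> L}" for x
  have less: "\<rho> x < \<rho> y" if "(x, y) \<in> L" for x y
  proof -
    have "x \<in> A" using that L(1) by blast
    have "{z \<in> A. (z, x) \<in> L} \<subset> {z \<in> A. (z, y) \<in> L}"
    proof
      show "{z \<in> A. (z, x) \<in> L} \<subseteq> {z \<in> A. (z, y) \<in> L}" using that L(2) by (auto dest: transD)
      have "(x, x) \<notin> L" using L(3) by (simp add: irrefl_def)
      then show "{z \<in> A. (z, x) \<in> L} \<noteq> {z \<in> A. (z, y) \<in> L}" using that \<open>x \<in> A\<close> by blast
    qed
    then show ?thesis using A by (simp add: \<rho>_def psubset_card_mono)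
  qed
  have iff: "(x, y) \<in> L \<longleftrightarrow> \<rho> x < \<rho> y" if "x \<in> A" "y \<in> A" for x y
    using less that L(4) by (metis less_asym total_on_def less_irrefl)
  have inj: "inj_on \<rho> A"
    using L(4) less unfolding inj_on_def total_on_def by (metis less_irrefl)
  \<comment> \<open>A polyhedron without vertices may lack the empty face that
    \<open>face_family\<close> requires. Adding it does not change the structure.\<close>
  define T where "T = insert {} ((`) \<rho> ` S)"
  have UT: "\<Union>T = \<rho> ` A" using S(1) by (auto simp: T_def)
  have T: "face_family T" unfolding face_family_def
  proof (intro conjI allI impI ballI)
    show "finite T" using finS by (simp add: T_def)
    show "finite u" if "u \<in> T" for u using that SA finite_subset[OF _ A] by (auto simp: T_def)
    fix u v assume "u \<subseteq> v \<and> v \<in> T"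
    then show "u \<in> T" using S(2) by (auto simp: T_def subset_image_iff)
  qed (simp add: T_def)
  have "card u \<le> k" if "u \<in> T" for u
    using that k SA finite_subset[OF _ A] by (auto simp: T_def intro: order_trans[OF card_image_le])
  moreover have "struct_iso \<rho> X (nat_poly T)"
    unfolding X nat_poly_def struct_iso_poly_struct[OF P ordered_polyhedron_nat[OF T]]
  proof (intro conjI allI impI ballI)
    show "bij_betw \<rho> A (\<Union>T)" using inj UT by (simp add: bij_betw_def)
    fix u assume u: "u \<subseteq> A" "u \<noteq> {}"
    have "\<rho> ` u = \<rho> ` v \<longleftrightarrow> u = v" if "v \<in> S" for v
      using inj_on_image_eq_iff[OF inj u(1) SA[OF that]] .
    then show "u \<in> S \<longleftrightarrow> \<rho> ` u \<in> T" using u by (auto simp: T_def)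
  next
    fix x y assume "x \<in> A" "y \<in> A"
    then show "(x, y) \<in> L \<longleftrightarrow> (\<rho> x, \<rho> y) \<in> {(x, y). x \<in> \<Union> T \<and> y \<in> \<Union> T \<and> x < y}"
      using iff UT by auto
  qed
  ultimately show ?thesis using that T by (auto simp: isomorphic_def)
qed

text \<open>The vertices stand for the nonempty subsets of \<open>{..<N}\<close>, a family of which is a face iff it
  has a common element; comparing codes downwards orders the subsets lexicographically.\<close>

definition common_faces :: "nat \<Rightarrow> nat \<Rightarrow> nat set set" where
  "common_faces k N = {u. u \<subseteq> {1..<2 ^ N} \<and> card u \<le> k \<and> (\<exists>n. \<forall>x\<in>u. n \<in> set_decode x)}"

definition common_poly :: "nat \<Rightarrow> nat \<Rightarrow> nat struct" where
  "common_poly k N = poly_struct {1..<2 ^ N} (common_faces k N)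
     {(x, y). x \<in> {1..<2 ^ N} \<and> y \<in> {1..<2 ^ N} \<and> y < x}"

lemma ordered_polyhedron_common:
  assumes "k > 0"
  shows "ordered_polyhedron {1..<2 ^ N} (common_faces k N)
     {(x, y). x \<in> {1..<2 ^ N} \<and> y \<in> {1..<2 ^ N} \<and> y < x}"
  unfolding ordered_polyhedron_def polyhedron_def
proof (intro conjI allI impI ballI)
  show "finite u" if "u \<in> common_faces k N" for u
    using that finite_subset by (auto simp: common_faces_def)
  show "\<Union>(common_faces k N) = {1..<2 ^ N}"
  proof
    show "{1..<2 ^ N} \<subseteq> \<Union>(common_faces k N)"
    proof
      fix x :: nat assume x: "x \<in> {1..<2 ^ N}"
      have "set_decode x \<noteq> {}"
      proof
        assume "set_decode x = {}"
        then have "x = 0" by (metis set_decode_inverse set_encode_empty)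
        then show False using x by simp
      qed
      then have "{x} \<in> common_faces k N" using x assms by (auto simp: common_faces_def)
      then show "x \<in> \<Union>(common_faces k N)" by blast
    qed
  qed (auto simp: common_faces_def)
  fix u v assume uv: "u \<subseteq> v \<and> v \<in> common_faces k N"
  then have "finite v" using finite_subset by (auto simp: common_faces_def)
  then have "card u \<le> card v" using uv by (simp add: card_mono)
  then show "u \<in> common_faces k N" using uv by (fastforce simp: common_faces_def)
qed (auto simp: strict_linear_order_on_def trans_def irrefl_def total_on_def)

lemma common_poly_KP: "k > 0 \<Longrightarrow> common_poly k N \<in> KP k"
  using ordered_polyhedron_common unfolding KP_def common_poly_def
  by (auto simp: common_faces_def) blast

text \<open>\<open>C\<close> is built over \<open>nat\<close> whatever \<open>'a\<close> is, since a
  finite type \<open>'a\<close> could be too small to hold it.\<close>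

theorem KP_ramsey:
  fixes A B :: "'a struct"
  assumes k: "k > 0" and r: "r > 0" and A: "A \<in> KP k" and B: "B \<in> KP k"
  shows "\<exists>C\<in>KP k. \<forall>c :: nat struct \<Rightarrow> nat. c ` copies C A \<subseteq> {..<r} \<longrightarrow>
             (\<exists>B'\<in>copies C B. \<exists>j<r. \<forall>A'\<in>copies B' A. c A' = j)"
proof -
  obtain SA where SA: "face_family SA" and A_iso: "A \<simeq> nat_poly SA"
    using KP_isomorphic_nat_poly[OF A] by blast
  obtain SB where SB: "face_family SB" "\<And>u. u \<in> SB \<Longrightarrow> card u \<le> k" and B_iso: "B \<simeq> nat_poly SB"
    using KP_isomorphic_nat_poly[OF B] by blast
  let ?A = "\<Union>SA" and ?B = "\<Union>SB"
  obtain N where N: "\<And>c :: nat set \<Rightarrow> nat. \<forall>Y. c Y < r \<Longrightarrow>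
    \<exists>h\<in>PW 0 (card SB) N. \<exists>j. \<forall>\<phi>. strict_mono_on ?A \<phi> \<longrightarrow>
       (\<forall>u\<subseteq>?A. u \<in> SA \<longleftrightarrow> \<phi> ` u \<in> SB) \<longrightarrow> c (vertex_code SB h ` \<phi> ` ?A) = j"
    using face_family_ramsey[OF SA SB(1), of r] by blast
  let ?V = "{1..<2 ^ N} :: nat set" and ?F = "common_faces k N"
  let ?L = "{(x, y). x \<in> ?V \<and> y \<in> ?V \<and> y < x}"
  define C where "C = common_poly k N"
  have C_eq: "C = poly_struct ?V ?F ?L" by (simp add: C_def common_poly_def)
  note C_ord = ordered_polyhedron_common[OF k, of N]
  have C_struct: "is_struct C" unfolding C_eq by (rule is_struct_poly_struct[OF C_ord])
  have "\<exists>B'\<in>copies C B. \<exists>j<r. \<forall>A'\<in>copies B' A. c A' = j" if c: "c ` copies C A \<subseteq> {..<r}"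
    for c :: "nat struct \<Rightarrow> nat"
  proof -
    \<comment> \<open>\<open>d\<close> must stay below \<open>r\<close> on all sets, whereas
      \<open>c\<close> is known to do so only on copies of \<open>A\<close>.\<close>
    define d where "d Y = (if c (induced C Y) < r then c (induced C Y) else 0)" for Y
    have "\<forall>Y. d Y < r" using r by (simp add: d_def)
    from N[OF this] obtain h j where h: "h \<in> PW 0 (card SB) N"
      and hj: "\<And>\<phi>. strict_mono_on ?A \<phi> \<Longrightarrow> (\<And>u. u \<subseteq> ?A \<Longrightarrow> u \<in> SA \<longleftrightarrow> \<phi> ` u \<in> SB) \<Longrightarrow>
        d (vertex_code SB h ` \<phi> ` ?A) = j" by blast
    define \<psi> where "\<psi> = vertex_code SB h"
    have range: "\<psi> ` ?B \<subseteq> ?V" unfolding \<psi>_def using vertex_code_range[OF SB(1) h] by blast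
    have anti: "\<psi> y < \<psi> x" if "x \<in> ?B" "y \<in> ?B" "x < y" for x y
      unfolding \<psi>_def using vertex_code_less[OF SB(1) h that] .
    have anti_iff: "\<psi> y < \<psi> x \<longleftrightarrow> x < y" if "x \<in> ?B" "y \<in> ?B" for x y
      using anti[of x y] anti[of y x] that by (cases x y rule: linorder_cases) auto
    have inj: "inj_on \<psi> ?B" using anti by (metis (no_types, lifting) inj_onI less_irrefl linorder_neqE_nat)
    have face: "u \<in> SB \<longleftrightarrow> \<psi> ` u \<in> ?F" if "u \<subseteq> ?B" for u
    proof -
      have "card (\<psi> ` u) = card u" using inj that by (meson card_image inj_on_subset)
      moreover have "\<psi> ` u \<subseteq> ?V" using range that by blast
      ultimately show ?thesis
        using vertex_code_face[OF SB(1) h that] SB(2) by (auto simp: common_faces_def \<psi>_def)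
    qed
    define B' where "B' = induced C (\<psi> ` ?B)"
    have B'_sub: "B' \<unlhd> C" unfolding B'_def
      by (rule induced_substruct[OF C_struct]) (use range in \<open>simp add: C_eq\<close>)
    have "struct_iso \<psi> (nat_poly SB) B'"
      unfolding B'_def C_eq induced_poly_struct nat_poly_def
        struct_iso_poly_struct[OF ordered_polyhedron_nat[OF SB(1)] ordered_polyhedron_restrict[OF C_ord range]]
    proof (intro conjI allI impI ballI)
      show "bij_betw \<psi> ?B (\<psi> ` ?B)" using inj by (simp add: bij_betw_def)
      show "u \<in> SB \<longleftrightarrow> \<psi> ` u \<in> {u \<in> ?F. u \<subseteq> \<psi> ` ?B}" if "u \<subseteq> ?B" for u
        using face[OF that] that by blast
      fix x y assume "x \<in> ?B" "y \<in> ?B"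
      then show "(x, y) \<in> {(x, y). x \<in> ?B \<and> y \<in> ?B \<and> x < y} \<longleftrightarrow> (\<psi> x, \<psi> y) \<in> ?L \<inter> \<psi> ` ?B \<times> \<psi> ` ?B"
        using anti_iff range by blast
    qed
    then have "B' \<simeq> B" using B_iso isomorphic_sym isomorphic_trans by (metis isomorphic_def)
    then have B'_copy: "B' \<in> copies C B" using B'_sub by (simp add: copies_def)
    have *: "c A' = j \<and> j < r" if A': "A' \<in> copies B' A" for A'
    proof -
      have sub: "A' \<unlhd> B'" and iso: "A' \<simeq> A" using A' by (auto simp: copies_def)
      have "nat_poly SA \<simeq> A'" using iso A_iso isomorphic_sym isomorphic_trans by blast
      then obtain f where f: "struct_iso f (nat_poly SA) A'" by (auto simp: isomorphic_def)
      have A'C: "A' \<unlhd> C" using sub B'_sub by (rule substruct_trans)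
      define U where "U = univ A'"
      have A'_eq: "A' = induced C U" unfolding U_def by (rule substruct_induced[OF A'C])
      have UV: "U \<subseteq> ?V" using A'C by (simp add: U_def substruct_def C_eq)
      have UB: "U \<subseteq> \<psi> ` ?B" using sub by (simp add: U_def substruct_def B'_def)
      have f: "bij_betw f ?A U \<and>
          (\<forall>u\<subseteq>?A. finite u \<longrightarrow> u \<noteq> {} \<longrightarrow> (u \<in> SA \<longleftrightarrow> f ` u \<in> {u \<in> ?F. u \<subseteq> U})) \<and>
          (\<forall>x\<in>?A. \<forall>y\<in>?A. (x, y) \<in> {(x, y). x \<in> ?A \<and> y \<in> ?A \<and> x < y} \<longleftrightarrow> (f x, f y) \<in> ?L \<inter> U \<times> U)"
        using f unfolding A'_eq C_eq induced_poly_struct nat_poly_def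
          struct_iso_poly_struct[OF ordered_polyhedron_nat[OF SA] ordered_polyhedron_restrict[OF C_ord UV]] .
      then have f_bij: "bij_betw f ?A U"
        and f_face: "\<And>u. u \<subseteq> ?A \<Longrightarrow> finite u \<Longrightarrow> u \<noteq> {} \<Longrightarrow> u \<in> SA \<longleftrightarrow> f ` u \<in> {u \<in> ?F. u \<subseteq> U}"
        by simp_all
      have f_less: "f y < f x" if "x \<in> ?A" "y \<in> ?A" "x < y" for x y
        using f[THEN conjunct2, THEN conjunct2, rule_format, OF that(1,2)] that by simp
      have finA: "finite ?A" using SA by (auto simp: face_family_def)
      \<comment> \<open>The copy is pulled back along \<psi> to an embedding of \<open>SA\<close>
        into \<open>SB\<close>.\<close>
      define \<phi> where "\<phi> a = inv_into ?B \<psi> (f a)" for a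
      have fU: "f a \<in> U" if "a \<in> ?A" for a using f_bij that by (rule bij_betwE[rule_format])
      have \<phi>: "\<phi> a \<in> ?B" "\<psi> (\<phi> a) = f a" if "a \<in> ?A" for a
      proof -
        have fa: "f a \<in> \<psi> ` ?B" using fU[OF that] UB by (rule subsetD[rotated])
        show "\<phi> a \<in> ?B" "\<psi> (\<phi> a) = f a"
          unfolding \<phi>_def using inv_into_into[OF fa] f_inv_into_f[OF fa] by blast+
      qed
      have im: "\<psi> ` \<phi> ` u = f ` u" if "u \<subseteq> ?A" for u
        unfolding image_image by (intro image_cong refl \<phi>(2) subsetD[OF that])
      \<comment> \<open>Both \<open>f\<close> and \<psi> reverse the order of the numbers, so \<phi>
        preserves it.\<close>
      have "strict_mono_on ?A \<phi>"
      proof (rule strict_mono_onI)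
        fix x y assume xy: "x \<in> ?A" "y \<in> ?A" "x < y"
        have "\<psi> (\<phi> y) < \<psi> (\<phi> x)" using f_less[OF xy] \<phi>(2) xy by simp
        then show "\<phi> x < \<phi> y" using anti_iff[OF \<phi>(1) \<phi>(1)] xy by blast
      qed
      moreover have "u \<in> SA \<longleftrightarrow> \<phi> ` u \<in> SB" if u: "u \<subseteq> ?A" for u
      proof (cases "u = {}")
        case True
        then show ?thesis using SA SB(1) by (simp add: face_family_def)
      next
        case False
        have "\<phi> ` u \<subseteq> ?B" using \<phi>(1) u by blast
        moreover have "f ` u \<subseteq> U" using fU u by blast
        ultimately show ?thesis
          using f_face[OF u finite_subset[OF u finA] False] face[of "\<phi> ` u"] im[OF u] by simp
      qed
      ultimately have "d (\<psi> ` \<phi> ` ?A) = j" unfolding \<psi>_def by (rule hj)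
      moreover have "\<psi> ` \<phi> ` ?A = U" using im[of ?A] f_bij by (simp add: bij_betw_def)
      moreover have "c A' < r" using c A'C iso by (auto simp: copies_def)
      ultimately show ?thesis using A'_eq by (auto simp: d_def)
    qed
    \<comment> \<open>If \<open>B'\<close> contains no copy of \<open>A\<close>, nothing forces
      \<open>j\<close> below \<open>r\<close>, and \<open>0\<close> takes its place.\<close>
    show ?thesis
      using * r by (intro bexI[OF _ B'_copy] exI[of _ "if j < r then j else 0"]) auto
  qed
  then show ?thesis
    by (intro rev_bexI[OF common_poly_KP[OF k, of N, folded C_def]]) blast
qed

section \<open>The Fraisse limit\<close>

lemma finite_sets_separated:
  fixes X Y :: "rat set"
  assumes "finite X" "finite Y" "\<And>x y. x \<in> X \<Longrightarrow> y \<in> Y \<Longrightarrow> x < y"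
  obtains z where "\<And>x. x \<in> X \<Longrightarrow> x < z" "\<And>y. y \<in> Y \<Longrightarrow> z < y"
proof (cases "X = {} \<or> Y = {}")
  case True
  obtain a where a: "\<And>x. x \<in> X \<Longrightarrow> x < a"
    using assms(1) by (metis Max_ge gt_ex order_le_less_trans)
  obtain b where b: "\<And>y. y \<in> Y \<Longrightarrow> b < y"
    using assms(2) by (metis Min_le lt_ex order_less_le_trans)
  show ?thesis using True a b that[of a] that[of b] by auto
next
  case False
  then have "Max X < Min Y" using assms by simp
  then obtain z where z: "Max X < z" "z < Min Y" using dense by blast
  show ?thesis
  proof (rule that[of z])
    show "x < z" if "x \<in> X" for x using Max_ge[OF assms(1) that] z by simp
    show "z < y" if "y \<in> Y" for y using Min_le[OF assms(2) that] z by simp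
  qed
qed

text \<open>Used to give distinct vertices distinct positions: finitely many earlier choices never
  exhaust an infinite set of candidates.\<close>

lemma injective_selection:
  fixes X :: "nat \<Rightarrow> 'b set"
  assumes "\<And>v. infinite (X v)"
  shows "\<exists>p. inj p \<and> (\<forall>v. p v \<in> X v)"
proof -
  have "\<exists>p. \<forall>v. p v \<in> X v \<and> (\<forall>w<v. p w \<noteq> p v)"
  proof (rule dependent_wellorder_choice)
    fix v and f :: "nat \<Rightarrow> 'b"
    have "infinite (X v - f ` {..<v})" using assms by simp
    then obtain r where "r \<in> X v - f ` {..<v}" using infinite_imp_nonempty by blast
    then show "\<exists>r. r \<in> X v \<and> (\<forall>w<v. f w \<noteq> r)" by blast
  qed auto
  then obtain p where p: "\<And>v. p v \<in> X v" "\<And>v w. w < v \<Longrightarrow> p w \<noteq> p v" by blast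
  have "inj p" using p(2) by (metis injI linorder_neqE_nat)
  then show ?thesis using p(1) by blast
qed

text \<open>The one-point extension axiom: \<open>X\<close> is a cut in the finite set
  \<open>W\<close>, and \<open>D\<close> is the link that the new vertex \<open>y\<close> shall have
  in \<open>W\<close>. \<open>{} \<in> D\<close> reflects that \<open>{y}\<close> is a face, and
  \<open>card w < k\<close> leaves room for \<open>y\<close>.\<close>

locale extension_property =
  fixes k :: nat and S :: "nat set set" and L :: "(nat \<times> nat) set"
  assumes k: "k > 0"
    and ord: "ordered_polyhedron UNIV S L"
    and card_face: "u \<in> S \<Longrightarrow> card u \<le> k"
    and extension: "finite W \<Longrightarrow> X \<subseteq> W \<Longrightarrow> (\<And>x y. x \<in> X \<Longrightarrow> y \<in> W - X \<Longrightarrow> (x, y) \<in> L) \<Longrightarrow>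
       {} \<in> D \<Longrightarrow> (\<And>w. w \<in> D \<Longrightarrow> w \<subseteq> W \<and> w \<in> S \<and> card w < k) \<Longrightarrow>
       (\<And>w w'. w' \<subseteq> w \<Longrightarrow> w \<in> D \<Longrightarrow> w' \<in> D) \<Longrightarrow>
       \<exists>y. y \<notin> W \<and> (\<forall>x\<in>X. (x, y) \<in> L) \<and> (\<forall>x\<in>W - X. (y, x) \<in> L) \<and> (\<forall>w\<subseteq>W. insert y w \<in> S \<longleftrightarrow> w \<in> D)"

text \<open>Every vertex \<open>v\<close> codes an open interval, a finite set \<open>D v\<close> of finite sets and an index. The
  position of \<open>v\<close> is chosen in the interval, and \<open>D v\<close> prescribes the link of \<open>v\<close> among the
  smaller vertices. As all indices occur, each prescription is met by arbitrarily large vertices.\<close>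

lemma extension_polyhedron:
  fixes k :: nat
  assumes k: "k > 0"
  obtains S L where "extension_property k S L"
proof -
  define code :: "nat \<Rightarrow> rat \<times> rat \<times> nat list list \<times> nat" where "code = from_nat"
  define D where "D v = set ` set (fst (snd (snd (code v))))" for v
  \<comment> \<open>A code without a proper interval leaves the position free, so that every
    \<open>I v\<close> is infinite.\<close>
  define I where "I v = (let (a, b, _) = code v in if a < b then {a<..<b} else UNIV)" for v
  have "infinite (I v)" for v
    by (auto simp: I_def split: prod.split simp: infinite_Ioo infinite_UNIV_char_0)
  then obtain pos where inj: "inj pos" and pos: "\<And>v. pos v \<in> I v"
    using injective_selection by blast
  have dense: "\<exists>v>n. D v = E \<and> a < pos v \<and> pos v < b"
    if "a < b" "finite E" "\<And>w. w \<in> E \<Longrightarrow> finite w" for a b E n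
  proof -
    \<comment> \<open>Lists stand for finite sets in the codes, to stay within a countable
      type.\<close>
    have "\<exists>l. E = set ` set l" using that(2,3)
    proof (induction E rule: finite_induct)
      case (insert w E)
      have "\<And>w. w \<in> E \<Longrightarrow> finite w" using insert.prems by simp
      then obtain l where l: "E = set ` set l" using insert.IH by blast
      moreover obtain xs where "set xs = w" using finite_list[of w] insert.prems[of w] by auto
      ultimately show ?case by (intro exI[of _ "xs # l"]) simp
    qed simp
    then obtain l where l: "E = set ` set l" by blast
    have "inj (\<lambda>i::nat. to_nat (a, b, l, i))" by (auto intro!: injI dest: injD[OF inj_to_nat])
    then have "infinite (range (\<lambda>i::nat. to_nat (a, b, l, i)))" by (rule range_inj_infinite)
    then obtain i where i: "n < to_nat (a, b, l, i :: nat)"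
      by (metis (no_types, lifting) finite_nat_set_iff_bounded_le not_less rangeE)
    have "code (to_nat (a, b, l, i)) = (a, b, l, i)" by (simp add: code_def)
    then show ?thesis
      using i l pos[of "to_nat (a, b, l, i)"] that(1)
      by (intro exI[of _ "to_nat (a, b, l, i)"]) (simp add: D_def I_def)
  qed
  \<comment> \<open>\<open>D v\<close> need not be closed under subsets; quantifying over all
    nonempty \<open>w\<close> makes \<open>S\<close> closed nevertheless.\<close>
  define S where "S = {u. finite u \<and> card u \<le> k \<and> (\<forall>v\<in>u. \<forall>w. w \<noteq> {} \<longrightarrow> w \<subseteq> u \<inter> {..<v} \<longrightarrow> w \<in> D v)}"
  define L where "L = {(x, y). pos x < pos y}"
  have S_mono: "u \<in> S" if "u \<subseteq> v" "v \<in> S" for u v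
  proof -
    have "card u \<le> card v" using that by (auto simp: S_def card_mono)
    moreover have v: "finite v" "card v \<le> k"
      and D: "\<And>x w. x \<in> v \<Longrightarrow> w \<noteq> {} \<Longrightarrow> w \<subseteq> v \<inter> {..<x} \<Longrightarrow> w \<in> D x"
      using that(2) by (simp_all add: S_def)
    moreover have "w \<in> D x" if "x \<in> u" "w \<noteq> {}" "w \<subseteq> u \<inter> {..<x}" for x w
      using that \<open>u \<subseteq> v\<close> by (intro D) auto
    ultimately show ?thesis using finite_subset[OF that(1) v(1)] unfolding S_def by simp
  qed
  have S_sing: "{x} \<in> S" for x using k by (auto simp: S_def)
  show ?thesis
  proof (rule that[of S L], unfold_locales)
    show "k > 0" by (rule k)
    have "pos x < pos y \<or> pos y < pos x" if "x \<noteq> y" for x y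
      using inj that by (metis injD linorder_neqE)
    then have "strict_linear_order_on UNIV L"
      unfolding strict_linear_order_on_def L_def trans_def irrefl_def total_on_def by auto
    moreover have "\<Union>S = UNIV" using S_sing by blast
    moreover have "\<forall>u\<in>S. finite u" by (simp add: S_def)
    moreover have "\<forall>u v. u \<subseteq> v \<and> v \<in> S \<longrightarrow> u \<in> S" using S_mono by blast
    ultimately show "ordered_polyhedron UNIV S L"
      unfolding ordered_polyhedron_def polyhedron_def by simp
    show "card u \<le> k" if "u \<in> S" for u using that by (simp add: S_def)
  next
    fix W X :: "nat set" and E
    assume W: "finite W" "X \<subseteq> W" and XL: "\<And>x y. x \<in> X \<Longrightarrow> y \<in> W - X \<Longrightarrow> (x, y) \<in> L"
      and E0: "{} \<in> E" and E: "\<And>w. w \<in> E \<Longrightarrow> w \<subseteq> W \<and> w \<in> S \<and> card w < k"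
      and E_mono: "\<And>w w'. w' \<subseteq> w \<Longrightarrow> w \<in> E \<Longrightarrow> w' \<in> E"
    have finX: "finite (pos ` X)" "finite (pos ` (W - X))"
      using W finite_subset by auto
    have sep: "x < y" if "x \<in> pos ` X" "y \<in> pos ` (W - X)" for x y using XL that by (auto simp: L_def)
    \<comment> \<open>Two separations, of \<open>X\<close> from the rest by \<open>a\<close> and of
      \<open>a\<close> from the rest by \<open>b\<close>, produce an interval inside the
      cut.\<close>
    obtain a where a: "\<And>x. x \<in> pos ` X \<Longrightarrow> x < a" "\<And>y. y \<in> pos ` (W - X) \<Longrightarrow> a < y"
      using finite_sets_separated[OF finX sep] by metis
    obtain b where b: "\<And>x. x \<in> {a} \<Longrightarrow> x < b" "\<And>y. y \<in> pos ` (W - X) \<Longrightarrow> b < y"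
      using finite_sets_separated[of "{a}", OF _ finX(2)] a(2) by (metis finite.emptyI finite.insertI singletonD)
    have "E \<subseteq> Pow W" using E by blast
    then have finE: "finite E" using W(1) by (meson finite_Pow_iff finite_subset)
    have "finite w" if "w \<in> E" for w using E[OF that] W(1) finite_subset by blast
    \<comment> \<open>As \<open>y\<close> exceeds all of \<open>W\<close>, every nonempty
      \<open>w\<close> in \<open>W\<close> is subject to the prescription \<open>D y\<close>. The
      \<open>0\<close> keeps \<open>Max\<close> meaningful for empty \<open>W\<close>.\<close>
    then obtain y where y: "Max (insert 0 W) < y" "D y = E" "a < pos y" "pos y < b"
      using dense[of a b E "Max (insert 0 W)"] b(1) finE by blast
    have Wy: "w < y" if "w \<in> W" for w using Max_ge[of "insert 0 W" w] W(1) that y(1) by simp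
    have "insert y w \<in> S \<longleftrightarrow> w \<in> E" if w: "w \<subseteq> W" for w
    proof -
      have finw: "finite w" using w W(1) by (rule finite_subset)
      have yw: "y \<notin> w" using Wy w by blast
      show ?thesis
      proof
        assume *: "insert y w \<in> S"
        show "w \<in> E"
        proof (cases "w = {}")
          case False
          have "w \<subseteq> insert y w \<inter> {..<y}" using Wy w by blast
          then have "w \<in> D y" using * False unfolding S_def by blast
          then show ?thesis using y(2) by simp
        qed (simp add: E0)
      next
        assume *: "w \<in> E"
        then have wS: "w \<in> S" "card w < k" using E by blast+
        have "w' \<in> D v" if v: "v \<in> insert y w" and w': "w' \<noteq> {}" "w' \<subseteq> insert y w \<inter> {..<v}" for v w'
        proof (cases "v = y")
          case True
          then have "w' \<subseteq> w" using w' by auto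
          then show ?thesis using E_mono * True y(2) by blast
        next
          case False
          then have "v \<in> w" using v by simp
          then have "v < y" using Wy w by blast
          then have "w' \<subseteq> w \<inter> {..<v}" using w' by auto
          then show ?thesis using wS(1) \<open>v \<in> w\<close> w'(1) unfolding S_def by blast
        qed
        then show "insert y w \<in> S" using finw yw wS(2) unfolding S_def by auto
      qed
    qed
    moreover have "y \<notin> W" using Wy by blast
    moreover have "(x, y) \<in> L" if "x \<in> X" for x using a(1)[of "pos x"] y(3) that by (simp add: L_def)
    moreover have "(y, x) \<in> L" if "x \<in> W - X" for x using b(2)[of "pos x"] y(4) that by (simp add: L_def)
    ultimately show "\<exists>y. y \<notin> W \<and> (\<forall>x\<in>X. (x, y) \<in> L) \<and> (\<forall>x\<in>W - X. (y, x) \<in> L) \<and>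
        (\<forall>w\<subseteq>W. insert y w \<in> S \<longleftrightarrow> w \<in> E)"
      by blast
  qed
qed

section \<open>Partial isomorphisms\<close>

lemma ordered_polyhedronD:
  assumes "ordered_polyhedron A S L"
  shows "u \<subseteq> v \<Longrightarrow> v \<in> S \<Longrightarrow> u \<in> S" and "x \<in> A \<Longrightarrow> {x} \<in> S"
    and "trans L" and "irrefl L" and "total_on A L"
proof -
  have S: "\<forall>u v. u \<subseteq> v \<and> v \<in> S \<longrightarrow> u \<in> S" "\<Union>S = A"
    using assms by (simp_all add: ordered_polyhedron_def polyhedron_def)
  show "u \<subseteq> v \<Longrightarrow> v \<in> S \<Longrightarrow> u \<in> S" using S(1) by blast
  show "{x} \<in> S" if x: "x \<in> A"
  proof -
    have "x \<in> \<Union>S" using x S(2) by simp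
    then obtain v where "x \<in> v" "v \<in> S" by (rule UnionE)
    then show ?thesis using S(1)[rule_format, of "{x}" v] by simp
  qed
  show "trans L" "irrefl L" "total_on A L"
    using assms by (simp_all add: ordered_polyhedron_def strict_linear_order_on_def)
qed

text \<open>A relation rather than a function, so that going back is going forth with the converse.
  Two polyhedra are allowed, so that one extension lemma yields both embeddings into the limit and
  automorphisms of it. Empty \<open>q\<close> is exempt because structures do not see the empty
  face.\<close>

definition partial_iso ::
  "'a set set \<Rightarrow> ('a \<times> 'a) set \<Rightarrow> 'b set set \<Rightarrow> ('b \<times> 'b) set \<Rightarrow> ('a \<times> 'b) set \<Rightarrow> bool" where
  "partial_iso S L S' L' p \<longleftrightarrow> finite p \<and>
    (\<forall>x y x' y'. (x, y) \<in> p \<longrightarrow> (x', y') \<in> p \<longrightarrow>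
      (x = x' \<longleftrightarrow> y = y') \<and> ((x, x') \<in> L \<longleftrightarrow> (y, y') \<in> L')) \<and>
    (\<forall>q\<subseteq>p. q \<noteq> {} \<longrightarrow> (fst ` q \<in> S \<longleftrightarrow> snd ` q \<in> S'))"

lemma partial_iso_converse:
  assumes "partial_iso S L S' L' p"
  shows "partial_iso S' L' S L (p\<inverse>)"
proof -
  have "fst ` q \<in> S' \<longleftrightarrow> snd ` q \<in> S" if "q \<subseteq> p\<inverse>" "q \<noteq> {}" for q
  proof -
    have "q\<inverse> \<subseteq> p" "q\<inverse> \<noteq> {}" using that by auto
    moreover have "fst ` (q\<inverse>) = snd ` q" "snd ` (q\<inverse>) = fst ` q" by force+
    ultimately show ?thesis using assms unfolding partial_iso_def by metis
  qed
  then show ?thesis using assms unfolding partial_iso_def by (auto; blast)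
qed

context extension_property
begin

text \<open>The cut and the link of \<open>x\<close> in the domain of \<open>p\<close> are carried
  over by \<open>p\<close>, and the extension property realises them by a vertex
  \<open>y\<close>.\<close>

lemma partial_iso_extend:
  assumes P: "ordered_polyhedron A T M" and cardT: "\<And>u. u \<in> T \<Longrightarrow> card u \<le> k"
    and p: "partial_iso T M S L p" and pA: "fst ` p \<subseteq> A" and x: "x \<in> A"
  shows "\<exists>y. partial_iso T M S L (insert (x, y) p)"
proof (cases "x \<in> fst ` p")
  case True
  then obtain y where "(x, y) \<in> p" by force
  then show ?thesis using p by (metis insert_absorb)
next
  case False
  note T = ordered_polyhedronD(1,2)[OF P] and M = ordered_polyhedronD(3-5)[OF P]
  note S = ordered_polyhedronD(1,2)[OF ord] and L = ordered_polyhedronD(3,4)[OF ord]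
  have finp: "finite p"
    and p1: "\<And>x y x' y'. (x, y) \<in> p \<Longrightarrow> (x', y') \<in> p \<Longrightarrow> (x = x' \<longleftrightarrow> y = y')"
    and p2: "\<And>x y x' y'. (x, y) \<in> p \<Longrightarrow> (x', y') \<in> p \<Longrightarrow> ((x, x') \<in> M \<longleftrightarrow> (y, y') \<in> L)"
    and p3: "\<And>q. q \<subseteq> p \<Longrightarrow> q \<noteq> {} \<Longrightarrow> fst ` q \<in> T \<longleftrightarrow> snd ` q \<in> S"
    using p unfolding partial_iso_def by blast+
  have inj: "inj_on fst p" "inj_on snd p" using p1 by (auto simp: inj_on_def)
  define W where "W = snd ` p"
  define X where "X = {y. \<exists>x'. (x', y) \<in> p \<and> (x', x) \<in> M}"
  define D where "D = {snd ` q |q. q \<subseteq> p \<and> insert x (fst ` q) \<in> T}"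
  have above: "(x, x') \<in> M" if "(x', y) \<in> p" "y \<notin> X" for x' y
  proof -
    have "x' \<in> A" "x' \<noteq> x" "(x', x) \<notin> M" using that pA False by (force simp: X_def)+
    then show ?thesis using M(3) x unfolding total_on_def by blast
  qed
  have "\<exists>y. y \<notin> W \<and> (\<forall>x\<in>X. (x, y) \<in> L) \<and> (\<forall>x\<in>W - X. (y, x) \<in> L) \<and> (\<forall>w\<subseteq>W. insert y w \<in> S \<longleftrightarrow> w \<in> D)"
  proof (rule extension)
    show "finite W" using finp by (simp add: W_def)
    show "X \<subseteq> W" by (force simp: X_def W_def)
    show "(y, y') \<in> L" if y: "y \<in> X" and y': "y' \<in> W - X" for y y'
    proof -
      obtain a where a: "(a, y) \<in> p" "(a, x) \<in> M" using y by (auto simp: X_def)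
      obtain a' where a': "(a', y') \<in> p" using y' by (force simp: W_def)
      have "(x, a') \<in> M" using above[OF a'] y' by blast
      then have "(a, a') \<in> M" using a(2) M(1) by (meson transD)
      then show ?thesis using p2[OF a(1) a'] by simp
    qed
    have "{x} \<in> T" using x by (rule T(2))
    then show "{} \<in> D" by (auto simp: D_def intro: exI[of _ "{}"])
    show "w \<subseteq> W \<and> w \<in> S \<and> card w < k" if w: "w \<in> D" for w
    proof -
      obtain q where q: "w = snd ` q" "q \<subseteq> p" "insert x (fst ` q) \<in> T" using w by (auto simp: D_def)
      have "finite q" using q(2) finp by (rule finite_subset)
      then have "card w = card (fst ` q)"
        using q(1,2) inj by (metis card_image inj_on_subset)
      moreover have "x \<notin> fst ` q" using False q(2) by blast
      then have "card (insert x (fst ` q)) = Suc (card (fst ` q))" using \<open>finite q\<close> by simp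
      then have "card (fst ` q) < k" using cardT[OF q(3)] by simp
      moreover have "w \<in> S"
      \<comment> \<open>The empty set escapes \<open>partial_iso\<close>, but it is a face because
        \<open>S\<close> is hereditary and nonempty.\<close>
      proof (cases "q = {}")
        case True
        then show ?thesis using q(1) S(1)[OF empty_subsetI S(2)[OF UNIV_I]] by simp
      next
        case False
        have "fst ` q \<in> T" using T(1)[OF _ q(3)] by blast
        then show ?thesis using p3[OF q(2) False] q(1) by simp
      qed
      ultimately show ?thesis using q(1,2) by (auto simp: W_def)
    qed
    show "w' \<in> D" if w: "w' \<subseteq> w" "w \<in> D" for w w'
    proof -
      obtain q where q: "w = snd ` q" "q \<subseteq> p" "insert x (fst ` q) \<in> T" using w by (auto simp: D_def)
      obtain q' where q': "q' \<subseteq> q" "w' = snd ` q'" using w(1) q(1) by (auto simp: subset_image_iff)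
      have "insert x (fst ` q') \<in> T" using q'(1) by (intro T(1)[OF _ q(3)]) blast
      then show ?thesis using q' q(2) unfolding D_def by blast
    qed
  qed
  then obtain y where "y \<notin> W \<and> (\<forall>x\<in>X. (x, y) \<in> L) \<and> (\<forall>x\<in>W - X. (y, x) \<in> L) \<and>
    (\<forall>w\<subseteq>W. insert y w \<in> S \<longleftrightarrow> w \<in> D)" ..
  then have y: "y \<notin> W" "\<And>z. z \<in> X \<Longrightarrow> (z, y) \<in> L" "\<And>z. z \<in> W - X \<Longrightarrow> (y, z) \<in> L"
    "\<And>w. w \<subseteq> W \<Longrightarrow> insert y w \<in> S \<longleftrightarrow> w \<in> D" by simp_all
  have face: "insert x (fst ` q) \<in> T \<longleftrightarrow> insert y (snd ` q) \<in> S" if q: "q \<subseteq> p" for q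
  proof -
    have "snd ` q \<in> D \<longleftrightarrow> insert x (fst ` q) \<in> T"
    proof
      assume "snd ` q \<in> D"
      then obtain q' where q': "snd ` q = snd ` q'" "q' \<subseteq> p" "insert x (fst ` q') \<in> T" by (auto simp: D_def)
      \<comment> \<open>\<open>D\<close> is about images only; injectivity of \<open>snd\<close> on
        \<open>p\<close> recovers the part of \<open>p\<close> itself.\<close>
      then have "q = q'" using inj_on_image_eq_iff[OF inj(2) q q'(2)] by simp
      then show "insert x (fst ` q) \<in> T" using q'(3) by simp
    qed (use q in \<open>auto simp: D_def\<close>)
    moreover have "snd ` q \<subseteq> W" using q by (auto simp: W_def)
    ultimately show ?thesis using y(4) by blast
  qed
  have irr: "(x, x) \<notin> M" "(y, y) \<notin> L" using M(2) L(2) by (auto simp: irrefl_def)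
  have asymM: "\<not> ((a, b) \<in> M \<and> (b, a) \<in> M)" for a b using M by (meson irrefl_def transD)
  have asymL: "\<not> ((a, b) \<in> L \<and> (b, a) \<in> L)" for a b using L by (meson irrefl_def transD)
  have new: "x \<noteq> x'" "y \<noteq> y'" "(x', x) \<in> M \<longleftrightarrow> (y', y) \<in> L" "(x, x') \<in> M \<longleftrightarrow> (y, y') \<in> L"
    if "(x', y') \<in> p" for x' y'
  proof -
    show "x \<noteq> x'" using False that by force
    have W: "y' \<in> W" using that by (force simp: W_def)
    then show "y \<noteq> y'" using y(1) by blast
    have X_iff: "y' \<in> X \<longleftrightarrow> (x', x) \<in> M" using that p1 by (auto simp: X_def)
    show "(x', x) \<in> M \<longleftrightarrow> (y', y) \<in> L" using X_iff y(2,3) W asymL by blast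
    show "(x, x') \<in> M \<longleftrightarrow> (y, y') \<in> L" using X_iff y(2,3) W asymL asymM above[OF that] by blast
  qed
  have "fst ` q \<in> T \<longleftrightarrow> snd ` q \<in> S" if q: "q \<subseteq> insert (x, y) p" "q \<noteq> {}" for q
  proof (cases "(x, y) \<in> q")
    case True
    then have "q = insert (x, y) (q - {(x, y)})" by blast
    moreover have "q - {(x, y)} \<subseteq> p" using q by blast
    ultimately show ?thesis using face by (metis fst_conv image_insert snd_conv)
  next
    case False
    then show ?thesis using q p3 by blast
  qed
  moreover have "(a = a' \<longleftrightarrow> b = b') \<and> ((a, a') \<in> M \<longleftrightarrow> (b, b') \<in> L)"
    if "(a, b) \<in> insert (x, y) p" "(a', b') \<in> insert (x, y) p" for a b a' b'
    using that new[of a b] new[of a' b'] p1[of a b a' b'] p2[of a b a' b'] irr by auto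
  ultimately have "partial_iso T M S L (insert (x, y) p)"
    using finp unfolding partial_iso_def by blast
  then show ?thesis by blast
qed

section \<open>The Fraisse structure\<close>

abbreviation (input) "F \<equiv> poly_struct UNIV S L"

lemma is_struct_F: "is_struct F"
  by (rule is_struct_poly_struct[OF ord])

lemma locally_finite_F: "locally_finite F"
  unfolding locally_finite_def
proof (intro allI impI)
  fix X :: "nat set" assume X: "finite X \<and> X \<subseteq> univ F"
  have "induced F X \<unlhd> F" by (rule induced_substruct[OF is_struct_F]) simp
  then have "\<Inter>{univ M |M. M \<unlhd> F \<and> X \<subseteq> univ M} \<subseteq> univ (induced F X)" by fastforce
  then show "finite (\<Inter>{univ M |M. M \<unlhd> F \<and> X \<subseteq> univ M})" using X finite_subset by auto
qed

text \<open>Stage \<open>n\<close> puts \<open>n\<close> into the domain and into the range. Faces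
  and order are tested on finite sets, each contained in one stage, so the union of the stages is an
  automorphism.\<close>

lemma partial_iso_automorphism:
  assumes p: "partial_iso S L S L p"
  obtains g where "struct_iso g F F" "\<And>x y. (x, y) \<in> p \<Longrightarrow> g x = y"
proof -
  have step: "\<exists>q. partial_iso S L S L q \<and> p \<subseteq> q \<and> n \<in> fst ` q \<and> n \<in> snd ` q"
    if p: "partial_iso S L S L p" for p n
  proof -
    obtain y where "partial_iso S L S L (insert (n, y) p)"
      using partial_iso_extend[OF ord card_face p subset_UNIV UNIV_I] by blast
    then have "partial_iso S L S L ((insert (n, y) p)\<inverse>)" by (rule partial_iso_converse)
    then obtain x where "partial_iso S L S L (insert (n, x) ((insert (n, y) p)\<inverse>))"
      using partial_iso_extend[OF ord card_face _ subset_UNIV UNIV_I] by blast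
    then have "partial_iso S L S L ((insert (n, x) ((insert (n, y) p)\<inverse>))\<inverse>)" by (rule partial_iso_converse)
    moreover have "(insert (n, x) ((insert (n, y) p)\<inverse>))\<inverse> = insert (x, n) (insert (n, y) p)" by auto
    ultimately show ?thesis by (intro exI[of _ "insert (x, n) (insert (n, y) p)"]) force
  qed
  obtain P where P: "\<And>n. partial_iso S L S L (P n)" "P 0 = p" "\<And>n. P n \<subseteq> P (Suc n)"
    "\<And>n. n \<in> fst ` P (Suc n)" "\<And>n. n \<in> snd ` P (Suc n)"
  proof -
    have "\<exists>P. \<forall>n. (partial_iso S L S L (P n) \<and> (n = 0 \<longrightarrow> P n = p)) \<and>
        (P n \<subseteq> P (Suc n) \<and> n \<in> fst ` P (Suc n) \<and> n \<in> snd ` P (Suc n))"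
      by (rule dependent_nat_choice) (use p step in auto)
    then show ?thesis using that by auto
  qed
  have mono: "P m \<subseteq> P n" if "m \<le> n" for m n using lift_Suc_mono_le[of P, OF P(3) that] .
  define R where "R = (\<Union>n. P n)"
  have fin: "\<exists>n. q \<subseteq> P n" if "finite q" "q \<subseteq> R" for q using that
  proof (induction q rule: finite_induct)
    case (insert z q)
    then obtain m n where "z \<in> P m" "q \<subseteq> P n" by (auto simp: R_def)
    then show ?case using mono[of m "max m n"] mono[of n "max m n"] by (intro exI[of _ "max m n"]) auto
  qed simp
  have R: "(x = x' \<longleftrightarrow> y = y') \<and> ((x, x') \<in> L \<longleftrightarrow> (y, y') \<in> L)" if xy: "(x, y) \<in> R" "(x', y') \<in> R" for x y x' y'
  proof -
    obtain n where "{(x, y), (x', y')} \<subseteq> P n" using fin[of "{(x, y), (x', y')}"] xy by auto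
    then show ?thesis using P(1)[of n] unfolding partial_iso_def by blast
  qed
  have "\<exists>y. (x, y) \<in> R" for x using P(4)[of x] by (force simp: R_def)
  then obtain g where g: "\<And>x. (x, g x) \<in> R" by metis
  have surj: "\<exists>x. g x = y" for y
  proof -
    obtain x where "(x, y) \<in> R" using P(5)[of y] by (force simp: R_def)
    then show ?thesis using R[OF g[of x], of x y] by blast
  qed
  have "struct_iso g F F"
    unfolding struct_iso_poly_struct[OF ord ord]
  proof (intro conjI allI impI ballI)
    show "bij_betw g UNIV UNIV" unfolding bij_betw_def
    proof
      show "inj g" using R[OF g g] by (auto intro: injI)
      show "range g = UNIV" using surj by (metis surjI)
    qed
    show "(x, y) \<in> L \<longleftrightarrow> (g x, g y) \<in> L" for x y using R[OF g g] by blast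
    fix u :: "nat set" assume u: "finite u" "u \<noteq> {}"
    let ?q = "(\<lambda>x. (x, g x)) ` u"
    have q: "finite ?q" "?q \<subseteq> R" "?q \<noteq> {}" using u g by auto
    then obtain n where "?q \<subseteq> P n" using fin by blast
    then have "fst ` ?q \<in> S \<longleftrightarrow> snd ` ?q \<in> S" using P(1)[of n] q(3) unfolding partial_iso_def by blast
    moreover have "fst ` ?q = u" "snd ` ?q = g ` u" by (force simp: image_image)+
    ultimately show "u \<in> S \<longleftrightarrow> g ` u \<in> S" by simp
  qed
  moreover have "g x = y" if "(x, y) \<in> p" for x y
  proof -
    have "(x, y) \<in> R" using that P(2) by (auto simp: R_def)
    then show ?thesis using R[OF g[of x], of x y] by blast
  qed
  ultimately show ?thesis using that by blast
qed

lemma ultrahomogeneous_F: "ultrahomogeneous F"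
  unfolding ultrahomogeneous_def
proof (intro allI impI)
  fix M N f
  assume *: "M \<unlhd> F \<and> N \<unlhd> F \<and> finite (univ M) \<and> finite (univ N) \<and> struct_iso f M N"
  define U V where "U = univ M" and "V = univ N"
  have "M = induced F U" unfolding U_def by (rule substruct_induced) (use * in blast)
  then have M: "M = poly_struct U {u \<in> S. u \<subseteq> U} (L \<inter> U \<times> U)"
    by (simp only: induced_poly_struct)
  have "N = induced F V" unfolding V_def by (rule substruct_induced) (use * in blast)
  then have N: "N = poly_struct V {u \<in> S. u \<subseteq> V} (L \<inter> V \<times> V)"
    by (simp only: induced_poly_struct)
  have iso: "struct_iso f M N" using * by blast
  have f: "bij_betw f U V \<and> (\<forall>u\<subseteq>U. finite u \<longrightarrow> u \<noteq> {} \<longrightarrow> (u \<in> {u \<in> S. u \<subseteq> U} \<longleftrightarrow> f ` u \<in> {u \<in> S. u \<subseteq> V})) \<and>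
    (\<forall>x\<in>U. \<forall>y\<in>U. (x, y) \<in> L \<inter> U \<times> U \<longleftrightarrow> (f x, f y) \<in> L \<inter> V \<times> V)"
    using iso unfolding M N
      struct_iso_poly_struct[OF ordered_polyhedron_restrict[OF ord subset_UNIV] ordered_polyhedron_restrict[OF ord subset_UNIV]]
    .
  have inj: "inj_on f U" and fV: "\<And>x. x \<in> U \<Longrightarrow> f x \<in> V" using f by (auto simp: bij_betw_def)
  have finU: "finite U" using * by (simp add: U_def)
  let ?p = "(\<lambda>x. (x, f x)) ` U"
  have "fst ` q \<in> S \<longleftrightarrow> snd ` q \<in> S" if q: "q \<subseteq> ?p" "q \<noteq> {}" for q
  proof -
    have u: "fst ` q \<subseteq> U" "snd ` q = f ` fst ` q" using q(1) by (force simp: image_image)+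
    have "finite (fst ` q)" using u(1) finU by (rule finite_subset)
    moreover have "f ` fst ` q \<subseteq> V" using u(1) fV by blast
    ultimately show ?thesis using f[THEN conjunct2, THEN conjunct1, rule_format, OF u(1)] u q(2) by simp
  qed
  moreover have "(x = x' \<longleftrightarrow> y = y') \<and> ((x, x') \<in> L \<longleftrightarrow> (y, y') \<in> L)"
    if xy: "(x, y) \<in> ?p" "(x', y') \<in> ?p" for x y x' y'
  proof -
    have x: "x \<in> U" "x' \<in> U" "y = f x" "y' = f x'" using xy by auto
    show ?thesis
      using f[THEN conjunct2, THEN conjunct2, rule_format, OF x(1,2)] x fV inj_on_eq_iff[OF inj x(1,2)] by simp
  qed
  ultimately have "partial_iso S L S L ?p" using finU unfolding partial_iso_def by blast
  then obtain g where "struct_iso g F F" "\<And>x y. (x, y) \<in> ?p \<Longrightarrow> g x = y"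
    using partial_iso_automorphism by blast
  then show "\<exists>g. struct_iso g F F \<and> (\<forall>x\<in>univ M. g x = f x)" by (auto simp: U_def)
qed

section \<open>The age of the Fraisse structure\<close>

lemma KP_subset_age: "KP k \<subseteq> (age F :: 'a struct set)"
proof
  fix X :: "'a struct" assume "X \<in> KP k"
  then obtain A T M where X: "X = poly_struct A T M" and P: "ordered_polyhedron A T M"
    and A: "finite A" and card: "\<And>u. u \<in> T \<Longrightarrow> card u \<le> k" by (auto simp: KP_def)
  \<comment> \<open>Going forth alone, one vertex at a time from the empty map.\<close>
  have "\<exists>p. partial_iso T M S L p \<and> fst ` p = A0" if "finite A0" "A0 \<subseteq> A" for A0 using that
  proof (induction A0 rule: finite_induct)
    case empty
    show ?case by (rule exI[of _ "{}"]) (simp add: partial_iso_def)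
  next
    case (insert x A0)
    then obtain p where p: "partial_iso T M S L p" "fst ` p = A0" by blast
    then obtain y where "partial_iso T M S L (insert (x, y) p)"
      using partial_iso_extend[OF P card p(1)] insert.prems by blast
    then show ?case using p(2) by (intro exI[of _ "insert (x, y) p"]) simp
  qed
  then obtain p where p: "partial_iso T M S L p" "fst ` p = A" using A by blast
  have "\<exists>y. (x, y) \<in> p" if "x \<in> A" for x using that p(2) by force
  then obtain f where f: "\<And>x. x \<in> A \<Longrightarrow> (x, f x) \<in> p" by metis
  have "struct_iso f X (induced F (f ` A))"
    unfolding X induced_poly_struct struct_iso_poly_struct[OF P ordered_polyhedron_restrict[OF ord subset_UNIV]]
  proof (intro conjI allI impI ballI)
    have "inj_on f A"
    proof (rule inj_onI)
      fix x x' assume "x \<in> A" "x' \<in> A" "f x = f x'"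
      then show "x = x'" using f p(1) unfolding partial_iso_def by metis
    qed
    then show "bij_betw f A (f ` A)" by (simp add: bij_betw_def)
    show "(x, y) \<in> M \<longleftrightarrow> (f x, f y) \<in> L \<inter> f ` A \<times> f ` A" if "x \<in> A" "y \<in> A" for x y
      using that f[OF that(1)] f[OF that(2)] p(1) unfolding partial_iso_def by blast
    fix u assume u: "u \<subseteq> A" "finite u" "u \<noteq> {}"
    let ?q = "(\<lambda>x. (x, f x)) ` u"
    have "?q \<subseteq> p" "?q \<noteq> {}" using u f by auto
    then have "fst ` ?q \<in> T \<longleftrightarrow> snd ` ?q \<in> S" using p(1) unfolding partial_iso_def by blast
    moreover have "fst ` ?q = u" "snd ` ?q = f ` u" by (force simp: image_image)+
    ultimately show "u \<in> T \<longleftrightarrow> f ` u \<in> {u \<in> S. u \<subseteq> f ` A}" using u(1) by auto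
  qed
  then have "X \<simeq> induced F (f ` A)" by (auto simp: isomorphic_def)
  moreover have "induced F (f ` A) \<unlhd> F" by (intro induced_substruct is_struct_F) simp
  moreover have "is_struct X" unfolding X by (rule is_struct_poly_struct[OF P])
  ultimately show "X \<in> age F" using A by (auto simp: age_def X)
qed

text \<open>Members of \<open>KP k\<close> have the form \<open>poly_struct A S L\<close>, so
  \<open>X\<close> must equal such a structure and not merely be isomorphic to one. Its faces are
  pulled back along \<open>f\<close>.\<close>

lemma age_subset_KP: "(age F :: 'a struct set) \<subseteq> KP k"
proof
  fix X :: "'a struct" assume "X \<in> age F"
  then obtain M f where X: "is_struct X" "finite (univ X)" and M: "M \<unlhd> F" and f: "struct_iso f X M"
    by (auto simp: age_def isomorphic_def)
  define U where "U = univ M"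
  have "M = induced F U" unfolding U_def by (rule substruct_induced[OF M])
  then have M: "M = poly_struct U {u \<in> S. u \<subseteq> U} (L \<inter> U \<times> U)"
    by (simp only: induced_poly_struct)
  define A T where "A = univ X" and "T = {u. u \<subseteq> A \<and> f ` u \<in> S}"
  have bij: "bij_betw f A U" using f by (simp add: struct_iso_def A_def U_def)
  have fU: "f x \<in> U" if "x \<in> A" for x using bij that by (rule bij_betwE[rule_format])
  have inj: "inj_on f A" using bij by (rule bij_betw_imp_inj_on)
  have LX: "Less X \<subseteq> A \<times> A" using X(1) by (simp add: is_struct_def A_def)
  have less: "(x, y) \<in> Less X \<longleftrightarrow> (f x, f y) \<in> L" if "x \<in> A" "y \<in> A" for x y
  proof -
    have "(x, y) \<in> Less X \<longleftrightarrow> (f x, f y) \<in> Less M" using f that by (simp add: struct_iso_def A_def)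
    then show ?thesis using fU that by (simp add: M)
  qed
  note S = ordered_polyhedronD(1,2)[OF ord] and L = ordered_polyhedronD(3-5)[OF ord]
  have finA: "finite A" using X(2) by (simp add: A_def)
  have "X = poly_struct A T (Less X)"
  proof (rule struct.equality)
    have "xs \<in> Rel X i \<longleftrightarrow> xs \<in> Rel (poly_struct A T (Less X)) i" for i xs
    proof (cases "i \<ge> 1 \<and> length xs = i \<and> set xs \<subseteq> A")
      case True
      then have "xs \<in> Rel X i \<longleftrightarrow> map f xs \<in> Rel M i"
        using f unfolding struct_iso_def A_def by blast
      also have "\<dots> \<longleftrightarrow> distinct xs \<and> f ` set xs \<in> S"
        using True fU inj by (auto simp: M distinct_map intro: inj_on_subset)
      finally show ?thesis using True by (auto simp: T_def)
    next
      case False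
      \<comment> \<open>\<open>is_struct\<close> excludes stray tuples, which \<open>f\<close> says
        nothing about.\<close>
      have "length xs = i \<and> set xs \<subseteq> A" if "xs \<in> Rel X i" "i \<ge> 1"
        using X(1) that unfolding is_struct_def A_def by blast
      moreover have "Rel X 0 = {}" using X(1) by (simp add: is_struct_def)
      ultimately have "xs \<notin> Rel X i" using False by (cases "i = 0") auto
      then show ?thesis using False by (auto simp: T_def)
    qed
    then show "Rel X = Rel (poly_struct A T (Less X))" by blast
  qed (simp_all add: A_def)
  moreover have "ordered_polyhedron A T (Less X)"
    unfolding ordered_polyhedron_def polyhedron_def
  proof (intro conjI allI impI ballI)
    show "countable A" using finA by (rule countable_finite)
    show "finite u" if "u \<in> T" for u using that finA finite_subset by (auto simp: T_def)
    show "u \<in> T" if "u \<subseteq> v \<and> v \<in> T" for u v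
      using that S(1)[of "f ` u" "f ` v"] by (auto simp: T_def)
    have "{x} \<in> T" if "x \<in> A" for x using that S(2) by (simp add: T_def)
    moreover have "T \<subseteq> Pow A" by (auto simp: T_def)
    ultimately show "\<Union>T = A" by blast
    show "Less X \<subseteq> A \<times> A" by (rule LX)
    show "strict_linear_order_on A (Less X)" unfolding strict_linear_order_on_def
    proof (intro conjI)
      show "trans (Less X)"
      proof (rule transI)
        fix x y z assume xyz: "(x, y) \<in> Less X" "(y, z) \<in> Less X"
        then have "x \<in> A" "y \<in> A" "z \<in> A" using LX by auto
        then show "(x, z) \<in> Less X" using xyz less L(1) by (meson transD)
      qed
      show "irrefl (Less X)" unfolding irrefl_def
        using LX less L(2) by (metis irrefl_def mem_Sigma_iff subsetD)
      show "total_on A (Less X)" unfolding total_on_def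
        using less L(3) inj by (metis UNIV_I inj_on_def total_on_def)
    qed
  qed
  moreover have "card u \<le> k" if "u \<in> T" for u
  proof -
    have "card (f ` u) = card u" using that inj by (intro card_image) (auto simp: T_def intro: inj_on_subset)
    then show ?thesis using that card_face[of "f ` u"] by (simp add: T_def)
  qed
  ultimately show "X \<in> KP k" using finA unfolding KP_def by blast
qed

lemma fraisse_struct_F: "fraisse_struct F"
  using is_struct_F locally_finite_F ultrahomogeneous_F by (simp add: fraisse_struct_def)

end

theorem KP_age:
  assumes "k > 0"
  shows "\<exists>F :: nat struct. fraisse_struct F \<and> (KP k :: 'a struct set) = age F"
proof -
  obtain S L where "extension_property k S L"
    using extension_polyhedron[OF assms] .
  then interpret extension_property k S L .
  show ?thesis
    using fraisse_struct_F KP_subset_age age_subset_KP by (intro exI[of _ "poly_struct UNIV S L"]) blast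
qed

theorem theorem6p1p2:
  fixes k :: nat
  assumes "k > 0"
  shows "(\<forall>r>1. \<forall>A\<in>KP k. \<forall>B\<in>KP k. (A :: 'a struct) \<unlhd> B \<longrightarrow>
           (\<exists>C\<in>KP k. \<forall>c :: nat struct \<Rightarrow> nat. c ` copies C A \<subseteq> {..<r} \<longrightarrow>
             (\<exists>B'\<in>copies C B. \<exists>j<r. \<forall>A'\<in>copies B' A. c A' = j)))
       \<and> (\<exists>F :: nat struct. fraisse_struct F \<and> (KP k :: 'a struct set) = age F)"
proof (intro conjI allI impI ballI)
  fix r :: nat and A B :: "'a struct"
  assume "1 < r" "A \<in> KP k" "B \<in> KP k"
  then show "\<exists>C\<in>KP k. \<forall>c :: nat struct \<Rightarrow> nat. c ` copies C A \<subseteq> {..<r} \<longrightarrow>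
      (\<exists>B'\<in>copies C B. \<exists>j<r. \<forall>A'\<in>copies B' A. c A' = j)"
    by (intro KP_ramsey[OF assms]) simp_all
qed (rule KP_age[OF assms])

end
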